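(* Consider the anisotropic XY chain on $\mathbb{Z}$ with periodic sequences (indexed by $j\in\mathbb{Z}$) $\mu_j\in\mathbb{R}\setminus\{0\}$, $\gamma_j\in\mathbb{R}\setminus\{\pm1\}$, $\nu_j\in\mathbb{R}$. There exists $v_0>0$ such that the following holds: if the Lieb–Robinson bound holds with some $C,\eta,v$ in the sense that for every $\Lambda=[m,n]\cap\mathbb{Z}$, all disjoint $S_1,S_2\subset\Lambda$, all $A\in\mathcal{A}_{S_1}$, $B\in\mathcal{A}_{S_2}$ and all $t\in\mathbb{R}$, $$\|[\tau^{(\Lambda)}_t(A),B]\|\le C\|A\|\,\|B\|\,e^{-\eta(d(S_1,S_2)-v|t|)},$$ where $\eta,v>0$ are uniform constants (independent of $\Lambda,S_1,S_2,A,B,t$) and $C>0$ may depend solely on the sizes of the interaction boundaries of $S_1$ and $S_2$, then $v\ge v_0$.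
   Context: For finite $S\subset\mathbb{Z}$, $\mathcal{A}_S=\bigotimes_{j\in S}M(2,\mathbb{C})$ acts on $\bigotimes_{j\in S}\mathbb{C}^2$; for $S_1\subset S_2$ one views $\mathcal{A}_{S_1}\subset\mathcal{A}_{S_2}$ via $A\mapsto A\otimes\mathbb{I}_{S_2\setminus S_1}$. For $\Lambda=[m,n]\cap\mathbb{Z}$, the XY Hamiltonian on $\bigotimes_{j=m}^n\mathbb{C}^2$ is $$H^{(\Lambda)}=\sum_{j=m}^{n-1}\mu_j\big[(1+\gamma_j)\sigma^{(x)}_j\sigma^{(x)}_{j+1}+(1-\gamma_j)\sigma^{(y)}_j\sigma^{(y)}_{j+1}\big]+\sum_{j=m}^n\nu_j\sigma^{(z)}_j,$$ where $\sigma^{(x)},\sigma^{(y)},\sigma^{(z)}$ are the Pauli matrices and the subscript $j$ means acting on the $j$-th tensor factor. The Heisenberg evolution is $\tau^{(\Lambda)}_t(A)=e^{itH^{(\Lambda)}}Ae^{-itH^{(\Lambda)}}$. The distance is $d(S_1,S_2)=\min_{(i,j)\in S_1\times S_2}|i-j|$. The interaction boundary of $S\subset\mathbb{Z}$ is $\partial S=\{n\in S:\{n-1,n+1\}\not\subset S\}$. *)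

theory Defs
  imports "HOL-Analysis.Analysis" "HOL-Library.Periodic_Fun"
begin

section \<open>Operators on a finite spin chain\<close>

text \<open>
  The standard basis of $\mathbb{C}^2$ is indexed by the library type \<open>2\<close>, so that
  $M(2,\mathbb{C})$ is \<open>complex^2^2\<close>. The product basis of
  $\bigotimes_{j\in S}\mathbb{C}^2$ is indexed by the (extensional) functions from \<open>S\<close> to \<open>2\<close>,
  and an operator on that space is given by its matrix in the product basis, set to \<open>0\<close> for
  indices outside \<open>confs S\<close>. For finite \<open>S\<close> the full matrix algebra obtained in this way is
  $\bigotimes_{j\in S}M(2,\mathbb{C})$: see \<open>tensor_mult\<close> and \<open>alg_expansion\<close> below.
\<close>

type_synonym conf = "int \<Rightarrow> 2"
type_synonym opr = "conf \<Rightarrow> conf \<Rightarrow> complex"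

definition confs :: "int set \<Rightarrow> conf set" where
  "confs S = S \<rightarrow>\<^sub>E UNIV"

definition alg :: "int set \<Rightarrow> opr set" where
  "alg S = {A. \<forall>s s'. s \<notin> confs S \<or> s' \<notin> confs S \<longrightarrow> A s s' = 0}"

definition tensor :: "int set \<Rightarrow> (int \<Rightarrow> complex^2^2) \<Rightarrow> opr" where
  "tensor S a s s' =
     (if s \<in> confs S \<and> s' \<in> confs S then \<Prod>j\<in>S. a j $ s j $ s' j else 0)"

definition op_one :: "int set \<Rightarrow> opr" where
  "op_one S = tensor S (\<lambda>_. mat 1)"

definition op_mult :: "int set \<Rightarrow> opr \<Rightarrow> opr \<Rightarrow> opr" where
  "op_mult S A B s s' = (\<Sum>r\<in>confs S. A s r * B r s')"

definition op_scale :: "complex \<Rightarrow> opr \<Rightarrow> opr" where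
  "op_scale c A s s' = c * A s s'"

primrec op_power :: "int set \<Rightarrow> opr \<Rightarrow> nat \<Rightarrow> opr" where
  "op_power S A 0 = op_one S"
| "op_power S A (Suc k) = op_mult S A (op_power S A k)"

definition op_exp :: "int set \<Rightarrow> opr \<Rightarrow> opr" where
  "op_exp S A s s' = (\<Sum>k. op_power S A k s s' / fact k)"

definition op_commutator :: "int set \<Rightarrow> opr \<Rightarrow> opr \<Rightarrow> opr" where
  "op_commutator S A B s s' = op_mult S A B s s' - op_mult S B A s s'"

definition op_apply :: "int set \<Rightarrow> opr \<Rightarrow> (conf \<Rightarrow> complex) \<Rightarrow> conf \<Rightarrow> complex" where
  "op_apply S A \<psi> s = (\<Sum>r\<in>confs S. A s r * \<psi> r)"

definition vec_norm :: "int set \<Rightarrow> (conf \<Rightarrow> complex) \<Rightarrow> real" where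
  "vec_norm S \<psi> = L2_set (\<lambda>s. cmod (\<psi> s)) (confs S)"

definition op_norm :: "int set \<Rightarrow> opr \<Rightarrow> real" where
  "op_norm S A = (SUP \<psi>\<in>{\<psi>. vec_norm S \<psi> \<le> 1}. vec_norm S (op_apply S A \<psi>))"

text \<open>The inclusion $A \mapsto A\otimes\mathbb{I}_{T\setminus S}$ of \<open>alg S\<close> into \<open>alg T\<close>,
  for \<open>S \<subseteq> T\<close>.\<close>

definition op_embed :: "int set \<Rightarrow> int set \<Rightarrow> opr \<Rightarrow> opr" where
  "op_embed S T A s s' =
     (if s \<in> confs T \<and> s' \<in> confs T
      then A (restrict s S) (restrict s' S) * op_one (T - S) (restrict s (T - S)) (restrict s' (T - S))
      else 0)"


section \<open>The anisotropic XY chain\<close>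

definition sigma_x :: "complex^2^2" where
  "sigma_x = vector [vector [0, 1], vector [1, 0]]"

definition sigma_y :: "complex^2^2" where
  "sigma_y = vector [vector [0, - \<i>], vector [\<i>, 0]]"

definition sigma_z :: "complex^2^2" where
  "sigma_z = vector [vector [1, 0], vector [0, - 1]]"

definition site_op :: "int set \<Rightarrow> int \<Rightarrow> complex^2^2 \<Rightarrow> opr" where
  "site_op S j a = tensor S (\<lambda>i. if i = j then a else mat 1)"

definition xy_hamiltonian ::
    "(int \<Rightarrow> real) \<Rightarrow> (int \<Rightarrow> real) \<Rightarrow> (int \<Rightarrow> real) \<Rightarrow> int \<Rightarrow> int \<Rightarrow> opr" where
  "xy_hamiltonian \<mu> \<gamma> \<nu> m n s s' =
     (\<Sum>j\<in>{m..<n}. of_real (\<mu> j) *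
        (of_real (1 + \<gamma> j) *
           op_mult {m..n} (site_op {m..n} j sigma_x) (site_op {m..n} (j + 1) sigma_x) s s' +
         of_real (1 - \<gamma> j) *
           op_mult {m..n} (site_op {m..n} j sigma_y) (site_op {m..n} (j + 1) sigma_y) s s')) +
     (\<Sum>j\<in>{m..n}. of_real (\<nu> j) * site_op {m..n} j sigma_z s s')"

definition xy_evolution ::
    "(int \<Rightarrow> real) \<Rightarrow> (int \<Rightarrow> real) \<Rightarrow> (int \<Rightarrow> real) \<Rightarrow> int \<Rightarrow> int \<Rightarrow> real \<Rightarrow> opr \<Rightarrow> opr" where
  "xy_evolution \<mu> \<gamma> \<nu> m n t A =
     (let H = xy_hamiltonian \<mu> \<gamma> \<nu> m n
      in op_mult {m..n}
           (op_mult {m..n} (op_exp {m..n} (op_scale (\<i> * of_real t) H)) A)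
           (op_exp {m..n} (op_scale (- \<i> * of_real t) H)))"


section \<open>Lieb--Robinson bounds\<close>

definition set_distance :: "int set \<Rightarrow> int set \<Rightarrow> int" where
  "set_distance S T = Min ((\<lambda>(i, j). \<bar>i - j\<bar>) ` (S \<times> T))"

definition interaction_boundary :: "int set \<Rightarrow> int set" where
  "interaction_boundary S = {n\<in>S. \<not> {n - 1, n + 1} \<subseteq> S}"

text \<open>
  The prefactor \<open>C\<close> is a positive function of the two boundary sizes. The sets \<open>S\<close> and \<open>T\<close> are
  taken to be nonempty because the distance is otherwise undefined.
\<close>

definition lieb_robinson ::
    "(int \<Rightarrow> real) \<Rightarrow> (int \<Rightarrow> real) \<Rightarrow> (int \<Rightarrow> real) \<Rightarrow> (nat \<Rightarrow> nat \<Rightarrow> real) \<Rightarrow> real \<Rightarrow> real \<Rightarrow> bool" where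
  "lieb_robinson \<mu> \<gamma> \<nu> C \<eta> v \<longleftrightarrow>
     (\<forall>k l. C k l > 0) \<and> \<eta> > 0 \<and> v > 0 \<and>
     (\<forall>m n S T A B t.
        S \<subseteq> {m..n} \<longrightarrow> T \<subseteq> {m..n} \<longrightarrow> S \<noteq> {} \<longrightarrow> T \<noteq> {} \<longrightarrow> S \<inter> T = {} \<longrightarrow>
        A \<in> alg S \<longrightarrow> B \<in> alg T \<longrightarrow>
        op_norm {m..n} (op_commutator {m..n}
            (xy_evolution \<mu> \<gamma> \<nu> m n t (op_embed S {m..n} A)) (op_embed T {m..n} B))
          \<le> C (card (interaction_boundary S)) (card (interaction_boundary T)) *
             op_norm S A * op_norm T B *
             exp (- \<eta> * (of_int (set_distance S T) - v * \<bar>t\<bar>)))"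


section \<open>Consistency of the matrix encoding\<close>

lemma finite_confs: "finite S \<Longrightarrow> finite (confs S)"
  unfolding confs_def by (intro finite_PiE) auto

lemma tensor_in_alg: "tensor S a \<in> alg S"
  by (auto simp: alg_def tensor_def)

lemma op_one_eq:
  assumes "finite S"
  shows "op_one S s s' = (if s \<in> confs S \<and> s' = s then 1 else 0)"
proof (cases "s \<in> confs S \<and> s' \<in> confs S")
  case True
  show ?thesis
  proof (cases "s = s'")
    case True
    then show ?thesis by (simp add: op_one_def tensor_def mat_def)
  next
    case False
    with True obtain j where "j \<in> S" "s j \<noteq> s' j"
      unfolding confs_def by (meson PiE_ext)
    then have "(\<Prod>j\<in>S. (mat 1 :: complex^2^2) $ s j $ s' j) = 0"
      using assms by (intro prod_zero) (auto simp: mat_def)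
    with False show ?thesis by (auto simp: op_one_def tensor_def)
  qed
qed (auto simp: op_one_def tensor_def)

lemma tensor_mult:
  assumes "finite S"
  shows "op_mult S (tensor S a) (tensor S b) = tensor S (\<lambda>j. a j ** b j)"
proof (intro ext)
  fix s s'
  show "op_mult S (tensor S a) (tensor S b) s s' = tensor S (\<lambda>j. a j ** b j) s s'"
  proof (cases "s \<in> confs S \<and> s' \<in> confs S")
    case True
    have "op_mult S (tensor S a) (tensor S b) s s' =
        (\<Sum>r\<in>confs S. \<Prod>j\<in>S. a j $ s j $ r j * b j $ r j $ s' j)"
      using True by (simp add: op_mult_def tensor_def prod.distrib)
    also have "\<dots> = (\<Prod>j\<in>S. \<Sum>x\<in>UNIV. a j $ s j $ x * b j $ x $ s' j)"
      unfolding confs_def using assms by (subst prod_sum_PiE) auto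
    finally show ?thesis
      using True by (simp add: tensor_def matrix_matrix_mult_def)
  qed (auto simp: op_mult_def tensor_def)
qed

lemma tensor_unit:
  assumes "finite S" "r \<in> confs S" "r' \<in> confs S"
  shows "tensor S (\<lambda>j. \<chi> x y. if x = r j \<and> y = r' j then 1 else 0) s s' =
    (if s = r \<and> s' = r' then 1 else 0)"
proof (cases "s \<in> confs S \<and> s' \<in> confs S")
  case True
  show ?thesis
  proof (cases "s = r \<and> s' = r'")
    case True
    then show ?thesis using assms by (simp add: tensor_def)
  next
    case False
    with True assms obtain j where "j \<in> S" "s j \<noteq> r j \<or> s' j \<noteq> r' j"
      unfolding confs_def by (meson PiE_ext)
    then have "(\<Prod>j\<in>S. (\<chi> x y. if x = r j \<and> y = r' j then (1 :: complex) else 0) $ s j $ s' j) = 0"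
      using assms by (intro prod_zero) auto
    with True False show ?thesis by (simp add: tensor_def del: vec_lambda_beta)
  qed
qed (use assms in \<open>auto simp: tensor_def\<close>)

lemma alg_expansion:
  assumes "finite S" "A \<in> alg S"
  shows "A s s' = (\<Sum>(r, r')\<in>confs S \<times> confs S.
           A r r' * tensor S (\<lambda>j. \<chi> x y. if x = r j \<and> y = r' j then 1 else 0) s s')"
proof -
  have "(\<Sum>(r, r')\<in>confs S \<times> confs S.
           A r r' * tensor S (\<lambda>j. \<chi> x y. if x = r j \<and> y = r' j then 1 else 0) s s')
      = (\<Sum>p\<in>confs S \<times> confs S. if p = (s, s') then A s s' else 0)"
    by (intro sum.cong refl) (auto simp: tensor_unit[OF assms(1)] split: if_splits)
  also have "\<dots> = A s s'"
    using assms by (auto simp: finite_confs alg_def)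
  finally show ?thesis by simp
qed

lemma op_embed_tensor:
  assumes "finite T" "S \<subseteq> T"
  shows "op_embed S T (tensor S a) = tensor T (\<lambda>j. if j \<in> S then a j else mat 1)"
proof (intro ext)
  fix s s'
  have res: "restrict r U \<in> confs U" for r U
    by (simp add: confs_def)
  show "op_embed S T (tensor S a) s s' = tensor T (\<lambda>j. if j \<in> S then a j else mat 1) s s'"
  proof (cases "s \<in> confs T \<and> s' \<in> confs T")
    case True
    have "(\<Prod>j\<in>T. (if j \<in> S then a j else mat 1) $ s j $ s' j) =
        (\<Prod>j\<in>T - S. (if j \<in> S then a j else mat 1) $ s j $ s' j) *
        (\<Prod>j\<in>S. (if j \<in> S then a j else mat 1) $ s j $ s' j)"
      using assms by (intro prod.subset_diff) auto
    also have "\<dots> = (\<Prod>j\<in>S. a j $ s j $ s' j) * (\<Prod>j\<in>T - S. mat 1 $ s j $ s' j)"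
      by (simp add: mult.commute)
    finally show ?thesis
      using True by (simp add: op_embed_def op_one_def tensor_def res)
  qed (auto simp: op_embed_def tensor_def)
qed

end

theory Submission
  imports "Jordan_Normal_Form.Char_Poly" "HOL-Complex_Analysis.Complex_Analysis" Defs
begin

text \<open>
  In the Jordan--Wigner Majorana operators \<open>a\<^sub>k\<close>, \<open>b\<^sub>k\<close> the Heisenberg evolution is linear, with a
  periodic tridiagonal generator. The Lieb--Robinson bound for Jordan--Wigner strings and single
  sites makes the one-particle propagator decay like $e^{-\eta(|k-j|-v|t|)}$, and by unitarity the
  same holds for every smaller rate \<open>2\<kappa>\<close>. Pairing the propagator with a complex Bloch wave
  \<open>\<alpha>\<^sub>k = y\<^sup>k \<phi>\<^sub>k\<close>, \<open>|y| = e\<^sup>\<kappa>\<close>, of eigenvalue \<open>\<zeta>\<close> produces the growth $e^{t\,\mathrm{Re}\,\zeta}$, whence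
  \<open>|Re \<zeta>| \<le> 2\<kappa>v\<close>. So the determinant \<open>D(y)\<close> of the squared Bloch matrix, a product of values \<open>-\<zeta>\<^sup>2/4\<close>,
  has imaginary part \<open>O(\<kappa>v)\<close> on \<open>|y| = e\<^sup>\<kappa>\<close>. Were \<open>v\<close> not bounded below, letting \<open>\<kappa> \<rightarrow> 0\<close> would force
  \<open>D\<close> to be constant on the unit circle. But \<open>D\<close> is a Laurent polynomial whose coefficient of
  \<open>y\<^bsup>2p\<^esup>\<close> is, up to sign, the product of all $\mu_j^2(1-\gamma_j^2)$ over a period \<open>p\<close>, which is nonzero.
\<close>

hide_const (open) Determinants.det
no_notation fps_nth (infixl "$" 75)

section \<open>Linear dynamics on a finite chain\<close>

text \<open>Jordan-Wigner strings are not local, but the interaction boundary of an interval has at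
  most two points. As the prefactor may depend on boundary sizes only, it stays bounded along the
  strings, and the many-body bound becomes a one-particle one.

  For each small v the bound comes with its own C and \<eta>, of which nothing is known, so both
  have to drop out: C is lost as t tends to infinity, and \<eta> only restricts \<kappa> to \<kappa>
  \<le> \<eta>/2. What remains is |Im D| \<le> K \<kappa> v with K depending on the chain alone.

  Single eigenvalues are branches of an algebraic function of y; their product is holomorphic for y
  \<noteq> 0. Every \<zeta> being nearly imaginary, each \<zeta>^2 is nearly real, and so is D.
  Since the estimate is of order \<kappa> v, it gives two facts on the unit circle: Im D vanishes,
  and, v being arbitrarily small, so does its radial derivative. By Cauchy-Riemann the latter is, up
  to sign, the tangential derivative of Re D.\<close>

lemma sum_telescope_int:
  fixes h :: "int \<Rightarrow> 'a::ab_group_add"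
  assumes "m \<le> n"
  shows "(\<Sum>k\<in>{m..n}. h k - h (k - 1)) = h n - h (m - 1)"
  using assms
proof (induction n rule: int_ge_induct)
  case (step n)
  have "{m..n + 1} = insert (n + 1) {m..n}" using step by auto
  then show ?case using step by simp
qed simp

text \<open>Let M be tridiagonal with entries u (k - 1), - \<nu> k, l k in row k. The system is f' =
  2 M g, g' = - 2 M^T f, with a real antisymmetric generator. The zero values off the chain express
  its open ends.\<close>

definition chain_ode ::
    "(int \<Rightarrow> real) \<Rightarrow> (int \<Rightarrow> real) \<Rightarrow> (int \<Rightarrow> real) \<Rightarrow> int \<Rightarrow> int \<Rightarrow> (int \<Rightarrow> real \<Rightarrow> complex) \<Rightarrow> (int \<Rightarrow> real \<Rightarrow> complex) \<Rightarrow> bool" where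
  "chain_ode u l \<nu> m n f g \<longleftrightarrow>
     (\<forall>k t. k \<notin> {m..n} \<longrightarrow> f k t = 0 \<and> g k t = 0) \<and>
     (\<forall>k\<in>{m..n}. \<forall>t.
       (f k has_vector_derivative
         2 *\<^sub>R (u (k - 1) *\<^sub>R g (k - 1) t + l k *\<^sub>R g (k + 1) t - \<nu> k *\<^sub>R g k t)) (at t) \<and>
       (g k has_vector_derivative
         (- 2) *\<^sub>R (u k *\<^sub>R f (k + 1) t + l (k - 1) *\<^sub>R f (k - 1) t - \<nu> k *\<^sub>R f k t)) (at t))"

text \<open>A real antisymmetric generator conserves the norm; this is the form in which unitarity
  enters.\<close>

lemma chain_ode_energy:
  assumes ode: "chain_ode u l \<nu> m n f g" and "m \<le> n"
  shows "(\<Sum>k\<in>{m..n}. (norm (f k t))\<^sup>2 + (norm (g k t))\<^sup>2) = (\<Sum>k\<in>{m..n}. (norm (f k 0))\<^sup>2 + (norm (g k 0))\<^sup>2)"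
proof -
  let ?f' = "\<lambda>k t. 2 *\<^sub>R (u (k - 1) *\<^sub>R g (k - 1) t + l k *\<^sub>R g (k + 1) t - \<nu> k *\<^sub>R g k t)"
  let ?g' = "\<lambda>k t. (- 2) *\<^sub>R (u k *\<^sub>R f (k + 1) t + l (k - 1) *\<^sub>R f (k - 1) t - \<nu> k *\<^sub>R f k t)"
  have out: "f k t = 0" "g k t = 0" if "k \<notin> {m..n}" for k t
    using ode that by (auto simp: chain_ode_def)
  have d: "((\<lambda>t. \<Sum>k\<in>{m..n}. f k t \<bullet> f k t + g k t \<bullet> g k t) has_vector_derivative
      (\<Sum>k\<in>{m..n}. (f k t \<bullet> ?f' k t + ?f' k t \<bullet> f k t) + (g k t \<bullet> ?g' k t + ?g' k t \<bullet> g k t))) (at t)" for t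
    using ode unfolding chain_ode_def
    by (intro has_vector_derivative_sum has_vector_derivative_add
        bounded_bilinear.has_vector_derivative[OF bounded_bilinear_inner]) auto
  have z: "(\<Sum>k\<in>{m..n}. (f k t \<bullet> ?f' k t + ?f' k t \<bullet> f k t) + (g k t \<bullet> ?g' k t + ?g' k t \<bullet> g k t)) = 0" for t
  proof -
    \<comment> \<open>The flow through the bond between k and k + 1. It vanishes at both ends
      because f and g are 0 off the chain.\<close>
    define P where "P k = 4 * (l k * (f k t \<bullet> g (k + 1) t) - u k * (f (k + 1) t \<bullet> g k t))" for k
    have "(\<Sum>k\<in>{m..n}. (f k t \<bullet> ?f' k t + ?f' k t \<bullet> f k t) + (g k t \<bullet> ?g' k t + ?g' k t \<bullet> g k t)) =
       (\<Sum>k\<in>{m..n}. P k - P (k - 1))"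
      by (intro sum.cong refl) (simp add: P_def inner_add_left inner_diff_left inner_add_right inner_diff_right
          inner_commute[of "g a t" "f b t" for a b] algebra_simps)
    also have "\<dots> = P n - P (m - 1)" by (rule sum_telescope_int[OF \<open>m \<le> n\<close>])
    also have "\<dots> = 0" by (simp add: P_def out)
    finally show ?thesis .
  qed
  obtain c where "(\<Sum>k\<in>{m..n}. f k t \<bullet> f k t + g k t \<bullet> g k t) = c" for t
    using has_vector_derivative_zero_constant[OF convex_UNIV d[unfolded z]] by auto
  then show ?thesis by (simp add: power2_norm_eq_inner)
qed

lemma chain_ode_le_1:
  assumes ode: "chain_ode u l \<nu> m n f g" and j: "j \<in> {m..n}" and k: "k \<in> {m..n}"
    and init: "\<And>k. k \<in> {m..n} \<Longrightarrow> f k 0 = (if k = j then 1 else 0) \<and> g k 0 = 0"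
  shows "norm (f k t) \<le> 1" "norm (g k t) \<le> 1"
proof -
  have "(\<Sum>k\<in>{m..n}. (norm (f k 0))\<^sup>2 + (norm (g k 0))\<^sup>2) = (\<Sum>k\<in>{m..n}. if k = j then 1 else 0)"
    by (intro sum.cong) (auto simp: init)
  also have "\<dots> = 1" using j by simp
  finally have "(\<Sum>k\<in>{m..n}. (norm (f k t))\<^sup>2 + (norm (g k t))\<^sup>2) = 1"
    using chain_ode_energy[OF ode, of t] j by simp
  moreover have "(norm (f k t))\<^sup>2 + (norm (g k t))\<^sup>2 \<le> (\<Sum>k\<in>{m..n}. (norm (f k t))\<^sup>2 + (norm (g k t))\<^sup>2)"
    using k by (intro member_le_sum) auto
  ultimately have "(norm (f k t))\<^sup>2 + (norm (g k t))\<^sup>2 \<le> 1" by simp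
  then have "(norm (f k t))\<^sup>2 \<le> 1\<^sup>2" "(norm (g k t))\<^sup>2 \<le> 1\<^sup>2"
    using zero_le_power2[of "norm (f k t)"] zero_le_power2[of "norm (g k t)"]
    unfolding power_one by linarith+
  then show "norm (f k t) \<le> 1" "norm (g k t) \<le> 1"
    by (auto intro: power2_le_imp_le)
qed

section \<open>Pairing solutions with Bloch waves\<close>

text \<open>A formal left eigenvector of the generator of the infinite chain: without ends, the
  pairing Q of (\<alpha>, \<beta>) with (f, g) would satisfy Q' = \<zeta> Q. No bound is imposed, as
  the waves of interest grow exponentially.\<close>

definition bloch_wave ::
    "(int \<Rightarrow> real) \<Rightarrow> (int \<Rightarrow> real) \<Rightarrow> (int \<Rightarrow> real) \<Rightarrow> complex \<Rightarrow> (int \<Rightarrow> complex) \<Rightarrow> (int \<Rightarrow> complex) \<Rightarrow> bool" where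
  "bloch_wave u l \<nu> \<zeta> \<alpha> \<beta> \<longleftrightarrow> (\<forall>k.
      \<zeta> * \<beta> k = 2 * (u k * \<alpha> (k + 1) + l (k - 1) * \<alpha> (k - 1) - \<nu> k * \<alpha> k) \<and>
      \<zeta> * \<alpha> k = - 2 * (u (k - 1) * \<beta> (k - 1) + l k * \<beta> (k + 1) - \<nu> k * \<beta> k))"

text \<open>Summation by parts. The wave does not stop where the chain does, so each end leaves a
  bond term: the wave just outside times f and g at the last site.\<close>

lemma chain_ode_bloch_deriv:
  fixes \<alpha> \<beta> :: "int \<Rightarrow> complex"
  assumes ode: "chain_ode u l \<nu> m n f g" and "m \<le> n" and bw: "bloch_wave u l \<nu> \<zeta> \<alpha> \<beta>"
  shows "((\<lambda>t. \<Sum>k\<in>{m..n}. \<alpha> k * f k t + \<beta> k * g k t) has_vector_derivative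
     \<zeta> * (\<Sum>k\<in>{m..n}. \<alpha> k * f k t + \<beta> k * g k t) +
     2 * (- \<alpha> (n + 1) * u n * g n t - \<alpha> (m - 1) * l (m - 1) * g m t
        + \<beta> (m - 1) * u (m - 1) * f m t + \<beta> (n + 1) * l n * f n t)) (at t)"
proof -
  let ?f' = "\<lambda>k t. 2 *\<^sub>R (u (k - 1) *\<^sub>R g (k - 1) t + l k *\<^sub>R g (k + 1) t - \<nu> k *\<^sub>R g k t)"
  let ?g' = "\<lambda>k t. (- 2) *\<^sub>R (u k *\<^sub>R f (k + 1) t + l (k - 1) *\<^sub>R f (k - 1) t - \<nu> k *\<^sub>R f k t)"
  have out: "f k t = 0" "g k t = 0" if "k \<notin> {m..n}" for k t
    using ode that by (auto simp: chain_ode_def)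
  have d: "((\<lambda>t. \<Sum>k\<in>{m..n}. \<alpha> k * f k t + \<beta> k * g k t) has_vector_derivative
      (\<Sum>k\<in>{m..n}. \<alpha> k * ?f' k t + \<beta> k * ?g' k t)) (at t)"
    using ode unfolding chain_ode_def
    by (intro has_vector_derivative_sum has_vector_derivative_add has_vector_derivative_mult_right) auto
  define P where "P k = 2 * (\<alpha> k * l k * g (k + 1) t - \<alpha> (k + 1) * u k * g k t
     + \<beta> (k + 1) * l k * f k t - \<beta> k * u k * f (k + 1) t)" for k
  have "\<alpha> k * ?f' k t + \<beta> k * ?g' k t = \<zeta> * (\<alpha> k * f k t + \<beta> k * g k t) + (P k - P (k - 1))" for k
  proof -
    have "\<zeta> * (\<alpha> k * f k t + \<beta> k * g k t) = (\<zeta> * \<alpha> k) * f k t + (\<zeta> * \<beta> k) * g k t"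
      by (simp add: algebra_simps)
    also have "\<dots> = - 2 * (u (k - 1) * \<beta> (k - 1) + l k * \<beta> (k + 1) - \<nu> k * \<beta> k) * f k t +
       2 * (u k * \<alpha> (k + 1) + l (k - 1) * \<alpha> (k - 1) - \<nu> k * \<alpha> k) * g k t"
      using bw by (simp only: bloch_wave_def)
    finally show ?thesis unfolding P_def scaleR_conv_of_real by (simp add: algebra_simps)
  qed
  then have "(\<Sum>k\<in>{m..n}. \<alpha> k * ?f' k t + \<beta> k * ?g' k t) =
      \<zeta> * (\<Sum>k\<in>{m..n}. \<alpha> k * f k t + \<beta> k * g k t) + (P n - P (m - 1))"
    by (simp add: sum.distrib sum_distrib_left[symmetric] sum_telescope_int[OF \<open>m \<le> n\<close>])
  also have "P n - P (m - 1) = 2 * (- \<alpha> (n + 1) * u n * g n t - \<alpha> (m - 1) * l (m - 1) * g m t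
        + \<beta> (m - 1) * u (m - 1) * f m t + \<beta> (n + 1) * l n * f n t)"
    by (simp add: P_def out algebra_simps)
  finally show ?thesis using d by simp
qed

lemma sum_exp_abs_int_le:
  fixes \<kappa> :: real
  assumes "\<kappa> > 0"
  shows "(\<Sum>k\<in>{- int N..int N}. exp (- \<kappa> * of_int \<bar>k\<bar>)) \<le> 2 / (1 - exp (- \<kappa>))"
proof -
  have "(\<Sum>k\<in>{- int N..int N}. exp (- \<kappa> * of_int \<bar>k\<bar>)) \<le>
      (\<Sum>k\<in>int ` {..N} \<union> (\<lambda>i. - int i) ` {..N}. exp (- \<kappa> * of_int \<bar>k\<bar>))"
  proof (rule sum_mono2)
    show "{- int N..int N} \<subseteq> int ` {..N} \<union> (\<lambda>i. - int i) ` {..N}"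
    proof
      fix k assume "k \<in> {- int N..int N}"
      then have "k = int (nat k) \<and> nat k \<le> N \<or> k = - int (nat (- k)) \<and> nat (- k) \<le> N" by auto
      then show "k \<in> int ` {..N} \<union> (\<lambda>i. - int i) ` {..N}" by blast
    qed
  qed auto
  also have "\<dots> \<le> (\<Sum>k\<in>int ` {..N}. exp (- \<kappa> * of_int \<bar>k\<bar>)) + (\<Sum>k\<in>(\<lambda>i. - int i) ` {..N}. exp (- \<kappa> * of_int \<bar>k\<bar>))"
    by (subst sum.union_inter[symmetric]) (auto intro!: sum_nonneg)
  also have "\<dots> = 2 * (\<Sum>i\<le>N. exp (- \<kappa>) ^ i)"
    by (simp add: sum.reindex inj_on_def exp_of_nat_mult[symmetric] mult.commute)
  also have "\<dots> \<le> 2 * (\<Sum>i. exp (- \<kappa>) ^ i)"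
    using assms by (intro mult_left_mono sum_le_suminf summable_geometric) auto
  also have "\<dots> = 2 / (1 - exp (- \<kappa>))"
    using assms by (subst suminf_geometric) auto
  finally show ?thesis .
qed

lemma exp_growth_le:
  assumes "a > 0" "\<And>t::real. t \<ge> 0 \<Longrightarrow> a * exp (x * t) \<le> K * exp (y * t)"
  shows "x \<le> y"
proof (rule ccontr)
  assume "\<not> x \<le> y"
  then have xy: "x - y > 0" by simp
  have K: "K > 0" using assms(2)[of 0] assms(1) by simp
  \<comment> \<open>At this time the left side is a exp (K / a) \<ge> a + K, which already exceeds
    K.\<close>
  define t where "t = (K / a) / (x - y)"
  have t: "t \<ge> 0" using xy K assms(1) by (simp add: t_def)
  have "a * exp ((x - y) * t) \<le> K"
    using assms(2)[OF t] by (simp add: left_diff_distrib exp_diff field_simps)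
  moreover have "(x - y) * t = K / a" using xy by (simp add: t_def)
  moreover have "exp (K / a) \<ge> 1 + K / a" by (rule exp_ge_add_one_self)
  then have "a * exp (K / a) \<ge> a * (1 + K / a)" using assms(1) by (intro mult_left_mono) auto
  then have "a * exp (K / a) > K" using assms(1) by (simp add: algebra_simps)
  ultimately show False by simp
qed

text \<open>The wave grows at rate at most \<kappa> in space and the solution decays at rate 2
  \<kappa>, so the pairing converges uniformly in N and the end terms are of order exp (- \<kappa>
  N). Letting N tend to infinity at fixed t leaves pure growth exp (Re \<zeta> t), which is then
  compared with exp (2 \<kappa> v t) for large t.\<close>

lemma bloch_growth_le:
  fixes f g :: "nat \<Rightarrow> int \<Rightarrow> real \<Rightarrow> complex"
  assumes ode: "\<And>N. N \<ge> N0 \<Longrightarrow> chain_ode u l \<nu> (- int N) (int N) (f N) (g N)"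
    and init: "\<And>N k. N \<ge> N0 \<Longrightarrow> k \<in> {- int N..int N} \<Longrightarrow> f N k 0 = (if k = j then 1 else 0) \<and> g N k 0 = 0"
    and j: "\<bar>j\<bar> \<le> int N0"
    and decay: "\<And>N k t. N \<ge> N0 \<Longrightarrow> k \<in> {- int N..int N} \<Longrightarrow> t \<ge> 0 \<Longrightarrow>
      norm (f N k t) \<le> C * exp (- (2 * \<kappa>) * (of_int \<bar>k\<bar> - v * t)) \<and>
      norm (g N k t) \<le> C * exp (- (2 * \<kappa>) * (of_int \<bar>k\<bar> - v * t))"
    and pos: "\<kappa> > 0" "v \<ge> 0" "B \<ge> 0"
    and ul: "\<And>k. \<bar>u k\<bar> \<le> B" "\<And>k. \<bar>l k\<bar> \<le> B"
    and bw: "bloch_wave u l \<nu> \<zeta> \<alpha> \<beta>"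
    and ab: "\<And>k. norm (\<alpha> k) \<le> A * exp (\<kappa> * of_int \<bar>k\<bar>)" "\<And>k. norm (\<beta> k) \<le> A * exp (\<kappa> * of_int \<bar>k\<bar>)"
    and nz: "\<alpha> j \<noteq> 0"
  shows "Re \<zeta> \<le> 2 * \<kappa> * v"
proof -
  have A: "A \<ge> 0" using order_trans[OF norm_ge_zero ab(1)[of 0]] by simp
  have C: "C \<ge> 0"
  proof -
    have "0 \<le> C * exp (- (2 * \<kappa>) * (of_int \<bar>0\<bar> - v * 0))"
      by (rule order_trans[OF norm_ge_zero conjunct1[OF decay[of N0 0 0]]]) auto
    then show ?thesis by simp
  qed
  \<comment> \<open>Two terms per site, times the geometric sum over both directions.\<close>
  define K where "K = 2 * A * C * (2 / (1 - exp (- \<kappa>)))"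
  show ?thesis
  proof (rule exp_growth_le)
    show "norm (\<alpha> j) > 0" using nz by simp
    fix t :: real assume t: "t \<ge> 0"
    define Q where "Q N s = (\<Sum>k\<in>{- int N..int N}. \<alpha> k * f N k s + \<beta> k * g N k s)" for N s
    \<comment> \<open>The 8 is an outer factor 2 times four end terms, each at most A exp (\<kappa>
      (N + 1)) B C exp (- 2 \<kappa> (N - v t)). The part depending on N, exp (- \<kappa>) ^ N, is
      split off.\<close>
    define E where "E = 8 * A * B * C * exp (\<kappa> + 2 * \<kappa> * v * t)"
    have Q_le: "norm (Q N t) \<le> K * exp (2 * \<kappa> * v * t)" if N: "N \<ge> N0" for N
    proof -
      have "norm (Q N t) \<le> (\<Sum>k\<in>{- int N..int N}. 2 * A * C * exp (2 * \<kappa> * v * t) * exp (- \<kappa> * of_int \<bar>k\<bar>))"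
        unfolding Q_def
      proof (rule sum_norm_le)
        fix k assume k: "k \<in> {- int N..int N}"
        let ?X = "A * exp (\<kappa> * of_int \<bar>k\<bar>) * (C * exp (- (2 * \<kappa>) * (of_int \<bar>k\<bar> - v * t)))"
        have "norm (\<alpha> k * f N k t) \<le> ?X" "norm (\<beta> k * g N k t) \<le> ?X"
          unfolding norm_mult using ab[of k] decay[OF N k t] A by (auto intro!: mult_mono)
        then have "norm (\<alpha> k * f N k t + \<beta> k * g N k t) \<le> 2 * ?X"
          using norm_triangle_ineq[of "\<alpha> k * f N k t" "\<beta> k * g N k t"] by linarith
        also have "2 * ?X = 2 * A * C * (exp (\<kappa> * of_int \<bar>k\<bar>) * exp (- (2 * \<kappa>) * (of_int \<bar>k\<bar> - v * t)))"
          by simp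
        also have "exp (\<kappa> * of_int \<bar>k\<bar>) * exp (- (2 * \<kappa>) * (of_int \<bar>k\<bar> - v * t)) =
            exp (2 * \<kappa> * v * t) * exp (- \<kappa> * of_int \<bar>k\<bar>)"
          unfolding exp_add[symmetric] by (simp add: algebra_simps)
        finally show "norm (\<alpha> k * f N k t + \<beta> k * g N k t) \<le>
            2 * A * C * exp (2 * \<kappa> * v * t) * exp (- \<kappa> * of_int \<bar>k\<bar>)" by (simp add: mult.assoc)
      qed
      also have "\<dots> = 2 * A * C * exp (2 * \<kappa> * v * t) * (\<Sum>k\<in>{- int N..int N}. exp (- \<kappa> * of_int \<bar>k\<bar>))"
        by (simp add: sum_distrib_left)
      also have "\<dots> \<le> 2 * A * C * exp (2 * \<kappa> * v * t) * (2 / (1 - exp (- \<kappa>)))"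
        using A C by (intro mult_left_mono sum_exp_abs_int_le pos) auto
      finally show ?thesis by (simp add: K_def mult_ac)
    qed
    have step: "norm (\<alpha> j) \<le> exp (- Re \<zeta> * t) * (K * exp (2 * \<kappa> * v * t)) + exp (norm \<zeta> * t) * E * t * exp (- \<kappa>) ^ N"
      if N: "N \<ge> N0" for N
    proof -
      define b where "b s = 2 * (- \<alpha> (int N + 1) * u (int N) * g N (int N) s
          - \<alpha> (- int N - 1) * l (- int N - 1) * g N (- int N) s
          + \<beta> (- int N - 1) * u (- int N - 1) * f N (- int N) s
          + \<beta> (int N + 1) * l (int N) * f N (int N) s)" for s
      have Qd: "(Q N has_vector_derivative \<zeta> * Q N s + b s) (at s)" for s
        using chain_ode_bloch_deriv[OF ode[OF N] _ bw, of s] unfolding Q_def[abs_def] b_def by simp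
      have ed: "((\<lambda>s. exp (- \<zeta> * of_real s)) has_vector_derivative - \<zeta> * exp (- \<zeta> * of_real s)) (at s)" for s
      proof -
        have "((\<lambda>z. exp (- \<zeta> * z)) has_field_derivative - \<zeta> * exp (- \<zeta> * of_real s)) (at (of_real s))"
          by (auto intro!: derivative_eq_intros)
        from has_vector_derivative_real_field[OF this] show ?thesis by simp
      qed
      \<comment> \<open>The integrating factor cancels \<zeta> Q, so only the end terms make this
        product vary, and the mean value inequality bounds its change.\<close>
      have Rd: "((\<lambda>s. exp (- \<zeta> * of_real s) * Q N s) has_vector_derivative exp (- \<zeta> * of_real s) * b s) (at s)" for s
        by (rule has_vector_derivative_eq_rhs[OF has_vector_derivative_mult[OF ed Qd]]) (simp add: algebra_simps)
      let ?D = "exp (norm \<zeta> * t) * (E * exp (- \<kappa>) ^ N)"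
      have bnd: "norm (exp (- \<zeta> * of_real s) * b s) \<le> ?D" if s: "s \<in> {0..t}" for s
      proof -
        have "- Re \<zeta> * s \<le> norm \<zeta> * s"
          using s abs_Re_le_cmod[of \<zeta>] by (intro mult_right_mono) auto
        also have "\<dots> \<le> norm \<zeta> * t" using s by (intro mult_left_mono) auto
        finally have e: "norm (exp (- \<zeta> * of_real s)) \<le> exp (norm \<zeta> * t)" by (simp add: norm_exp)
        let ?X = "A * exp (\<kappa> * (real N + 1)) * B * (C * exp (- (2 * \<kappa>) * (real N - v * t)))"
        have s0: "s \<ge> 0" using s by simp
        have "C * exp (- (2 * \<kappa>) * (of_int \<bar>k\<bar> - v * s)) \<le> C * exp (- (2 * \<kappa>) * (real N - v * t))"
          if "k = int N \<or> k = - int N" for k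
        proof -
          have "v * s \<le> v * t" using s pos by (intro mult_left_mono) auto
          then have "(2 * \<kappa>) * (v * s) \<le> (2 * \<kappa>) * (v * t)"
            by (rule mult_left_mono) (use pos in auto)
          then show ?thesis using that C s by (intro mult_left_mono) (auto simp: algebra_simps)
        qed
        then have fg: "norm (f N k s) \<le> C * exp (- (2 * \<kappa>) * (real N - v * t))"
            "norm (g N k s) \<le> C * exp (- (2 * \<kappa>) * (real N - v * t))" if "k = int N \<or> k = - int N" for k
          using that decay[OF N _ s0, of k] by (fastforce intro: order_trans)+
        have abN: "norm (\<alpha> k) \<le> A * exp (\<kappa> * (real N + 1))" "norm (\<beta> k) \<le> A * exp (\<kappa> * (real N + 1))"
          if "k = int N + 1 \<or> k = - int N - 1" for k
          using that ab[of k] by (auto simp: add.commute)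
        have m: "norm (x * of_real w * y) \<le> ?X"
          if "norm x \<le> A * exp (\<kappa> * (real N + 1))" "\<bar>w\<bar> \<le> B" "norm y \<le> C * exp (- (2 * \<kappa>) * (real N - v * t))"
          for x y :: complex and w
          unfolding norm_mult norm_of_real
          by (intro mult_mono that) (use A C pos in auto)
        have tri: "norm (w - x + y + z) \<le> norm w + norm x + norm y + norm z" for w x y z :: complex
          using norm_triangle_ineq[of "w - x + y" z] norm_triangle_ineq[of "w - x" y] norm_triangle_ineq4[of w x]
          by linarith
        have q1: "norm (- \<alpha> (int N + 1) * u (int N) * g N (int N) s) \<le> ?X"
          by (rule m) (use abN(1)[of "int N + 1"] ul(1) fg(2)[of "int N"] in auto)
        have q2: "norm (\<alpha> (- int N - 1) * l (- int N - 1) * g N (- int N) s) \<le> ?X"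
          by (rule m) (use abN(1)[of "- int N - 1"] ul(2) fg(2)[of "- int N"] in auto)
        have q3: "norm (\<beta> (- int N - 1) * u (- int N - 1) * f N (- int N) s) \<le> ?X"
          by (rule m) (use abN(2)[of "- int N - 1"] ul(1) fg(1)[of "- int N"] in auto)
        have q4: "norm (\<beta> (int N + 1) * l (int N) * f N (int N) s) \<le> ?X"
          by (rule m) (use abN(2)[of "int N + 1"] ul(2) fg(1)[of "int N"] in auto)
        have "norm (b s) \<le> 2 * (?X + ?X + ?X + ?X)"
          unfolding b_def norm_mult[of 2] norm_numeral
          by (intro mult_left_mono order_trans[OF tri add_mono[OF add_mono[OF add_mono[OF q1 q2] q3] q4]]) simp
        also have "2 * (?X + ?X + ?X + ?X) = 8 * ?X" by simp
        also have "8 * ?X = 8 * A * B * C * (exp (\<kappa> * (real N + 1)) * exp (- (2 * \<kappa>) * (real N - v * t)))"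
          by simp
        also have "exp (\<kappa> * (real N + 1)) * exp (- (2 * \<kappa>) * (real N - v * t)) =
            exp (\<kappa> + 2 * \<kappa> * v * t) * exp (- \<kappa>) ^ N"
          unfolding exp_of_nat_mult[symmetric] exp_add[symmetric] by (simp add: algebra_simps)
        finally have "norm (b s) \<le> E * exp (- \<kappa>) ^ N" by (simp add: E_def)
        then show ?thesis unfolding norm_mult using e by (intro mult_mono) auto
      qed
      have "norm (exp (- \<zeta> * of_real t) * Q N t - exp (- \<zeta> * of_real 0) * Q N 0) \<le> ?D * norm (t - 0)"
      proof (rule differentiable_bound[of "{0..t}"])
        fix s assume s: "s \<in> {0..t}"
        show "((\<lambda>s. exp (- \<zeta> * of_real s) * Q N s) has_derivative (\<lambda>h. h *\<^sub>R (exp (- \<zeta> * of_real s) * b s))) (at s within {0..t})"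
          using has_vector_derivative_at_within[OF Rd[of s]] by (simp add: has_vector_derivative_def)
        have "0 \<le> ?D" using bnd[OF s] norm_ge_zero order_trans by blast
        then show "onorm (\<lambda>h. h *\<^sub>R (exp (- \<zeta> * of_real s) * b s)) \<le> ?D"
          by (intro onorm_le, unfold norm_scaleR real_norm_def, subst mult.commute)
            (intro mult_right_mono bnd[OF s] abs_ge_zero)
      qed (use t in auto)
      moreover have "Q N 0 = \<alpha> j"
      proof -
        have "Q N 0 = (\<Sum>k\<in>{- int N..int N}. if k = j then \<alpha> k else 0)"
          unfolding Q_def by (intro sum.cong refl) (simp add: init N)
        also have "\<dots> = \<alpha> j" using j N by (simp, linarith)
        finally show ?thesis .
      qed
      ultimately have "norm (exp (- \<zeta> * of_real t) * Q N t - \<alpha> j) \<le> ?D * t" using t by simp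
      moreover have "norm (exp (- \<zeta> * of_real t) * Q N t) \<le> exp (- Re \<zeta> * t) * (K * exp (2 * \<kappa> * v * t))"
        using Q_le[OF N] by (simp add: norm_mult norm_exp)
      moreover have "norm (\<alpha> j) \<le> norm (exp (- \<zeta> * of_real t) * Q N t) + norm (exp (- \<zeta> * of_real t) * Q N t - \<alpha> j)"
        by (metis norm_minus_commute norm_triangle_sub)
      ultimately show ?thesis by (simp add: mult_ac)
    qed
    \<comment> \<open>With t fixed, N tends to infinity and the ends disappear.\<close>
    have lim: "(\<lambda>N. exp (- Re \<zeta> * t) * (K * exp (2 * \<kappa> * v * t)) + exp (norm \<zeta> * t) * E * t * exp (- \<kappa>) ^ N)
       \<longlonglongrightarrow> exp (- Re \<zeta> * t) * (K * exp (2 * \<kappa> * v * t)) + exp (norm \<zeta> * t) * E * t * 0"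
      using pos by (intro tendsto_intros LIMSEQ_realpow_zero) auto
    have "norm (\<alpha> j) \<le> exp (- Re \<zeta> * t) * (K * exp (2 * \<kappa> * v * t)) + exp (norm \<zeta> * t) * E * t * 0"
      by (rule LIMSEQ_le_const[OF lim]) (use step in blast)
    then have "norm (\<alpha> j) * exp (Re \<zeta> * t) \<le> exp (- Re \<zeta> * t) * (K * exp (2 * \<kappa> * v * t)) * exp (Re \<zeta> * t)"
      by (intro mult_right_mono) auto
    also have "\<dots> = K * exp (2 * \<kappa> * v * t)" by (simp add: exp_minus field_simps)
    finally show "norm (\<alpha> j) * exp (Re \<zeta> * t) \<le> K * exp (2 * \<kappa> * v * t)" .
  qed
qed

section \<open>Bloch matrices\<close>

no_notation vec_nth (infixl "$" 90)

lemma periodic_fun_simple_plus_multiple: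
  fixes f :: "int \<Rightarrow> 'a"
  assumes "periodic_fun_simple f q"
  shows "f (k + c * q) = f k"
proof (induction c rule: int_induct[of _ 0])
  case (step1 c)
  then show ?case
    using periodic_fun_simple.plus_period[OF assms, of "k + c * q"] by (simp add: algebra_simps)
next
  case (step2 c)
  then show ?case
    using periodic_fun_simple.plus_period[OF assms, of "k + (c - 1) * q"] by (simp add: algebra_simps)
qed simp

lemma periodic_fun_simple_mod:
  fixes f :: "int \<Rightarrow> 'a"
  assumes "periodic_fun_simple f q"
  shows "f (k mod q) = f k"
  using periodic_fun_simple_plus_multiple[OF assms, of "k mod q" "k div q"]
  by (simp add: add.commute[of "k mod q"])

text \<open>For \<open>p \<le> 2\<close> some of the three positions coincide, and their contributions add up.\<close>

definition hop :: "nat \<Rightarrow> (int \<Rightarrow> real) \<Rightarrow> (int \<Rightarrow> real) \<Rightarrow> (int \<Rightarrow> real) \<Rightarrow> complex \<Rightarrow> complex \<Rightarrow> complex \<Rightarrow> complex mat" where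
  "hop p a b d x y z = Matrix.mat p p (\<lambda>(i, j).
     (if j = (i + 1) mod p then of_real (a (int i)) * x else 0) +
     (if j = (i + p - 1) mod p then of_real (b (int i)) * y else 0) +
     (if j = i then of_real (d (int i)) * z else 0))"

lemma hop_carrier [simp]: "hop p a b d x y z \<in> carrier_mat p p"
  by (simp add: hop_def)

lemma hop_mult_vec:
  assumes "i < p" "w \<in> carrier_vec p"
  shows "(hop p a b d x y z *\<^sub>v w) $ i = of_real (a (int i)) * x * w $ ((i + 1) mod p) +
    of_real (b (int i)) * y * w $ ((i + p - 1) mod p) + of_real (d (int i)) * z * w $ i"
proof -
  have "(hop p a b d x y z *\<^sub>v w) $ i = (\<Sum>j\<in>{0..<p}.
     (if j = (i + 1) mod p then of_real (a (int i)) * x * w $ ((i + 1) mod p) else 0) +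
     (if j = (i + p - 1) mod p then of_real (b (int i)) * y * w $ ((i + p - 1) mod p) else 0) +
     (if j = i then of_real (d (int i)) * z * w $ i else 0))"
    using assms unfolding hop_def
    by (auto simp: scalar_prod_def distrib_right intro!: sum.cong)
  then show ?thesis using assms(1) by (simp add: sum.distrib)
qed

lemma hop_scale: "hop p a b d (c * x) (c * y) (c * z) = c \<cdot>\<^sub>m hop p a b d x y z"
  by (rule eq_matI) (auto simp: hop_def algebra_simps)

text \<open>Here e stands for 1 / y. Once y is pulled out of every row, the entries are polynomials
  in e, so the determinant extends to e = 0, that is, to y at infinity.\<close>

lemma det_hop_holomorphic: "(\<lambda>e. det (hop p a b d 1 (e ^ 2) (- e))) holomorphic_on UNIV"
proof -
  have "(\<lambda>e. hop p a b d 1 (e ^ 2) (- e) $$ (i, j)) holomorphic_on UNIV" if "i < p" "j < p" for i j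
    unfolding hop_def using that
    by (cases "j = (i + 1) mod p"; cases "j = (i + p - 1) mod p"; cases "j = i")
       (auto intro!: holomorphic_intros)
  moreover have "q i < p" if "q permutes {0..<p}" "i < p" for q i
    using permutes_in_image[OF that(1), of i] that(2) by simp
  ultimately show ?thesis
    unfolding det_def'[OF hop_carrier]
    by (intro holomorphic_on_sum holomorphic_on_mult holomorphic_on_prod holomorphic_on_const) auto
qed

text \<open>Only a weighted cyclic shift is left at e = 0. Showing that its kernel is trivial avoids
  the sign of the cyclic permutation.\<close>

lemma det_hop_0:
  assumes "p > 0" "\<And>k. a k \<noteq> 0"
  shows "det (hop p a b d 1 0 0) \<noteq> 0"
proof
  assume "det (hop p a b d 1 0 0) = 0"
  then obtain w where w: "w \<in> carrier_vec p" "w \<noteq> 0\<^sub>v p" "hop p a b d 1 0 0 *\<^sub>v w = 0\<^sub>v p"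
    unfolding det_0_iff_vec_prod_zero_field[OF hop_carrier] by auto
  have "w $ j = 0" if j: "j < p" for j
  proof -
    \<comment> \<open>The cyclic predecessor of j, with p added so that the subtraction stays in the
      natural numbers. Row i of the kernel equation involves only the entry j.\<close>
    define i where "i = (j + p - 1) mod p"
    have i: "i < p" using assms(1) by (simp add: i_def)
    have "(i + 1) mod p = (j + p - 1 + 1) mod p" unfolding i_def by (rule mod_add_left_eq)
    also have "\<dots> = j" using assms(1) j by simp
    finally show ?thesis using hop_mult_vec[OF i w(1), of a b d 1 0 0] w(3) i assms(2)[of "int i"] by simp
  qed
  then have "w = 0\<^sub>v p" using w(1) by (intro eq_vecI) auto
  with w(2) show False by simp
qed

text \<open>The characteristic polynomial splits over the complex numbers; its value at 0 is the
  determinant up to the sign (-1)^n, which cancels.\<close>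

lemma det_eq_prod_eigenvalues:
  fixes M :: "complex mat"
  assumes M: "M \<in> carrier_mat n n"
  obtains \<rho> where "det M = (\<Prod>i<n. \<rho> i)" "\<And>i. i < n \<Longrightarrow> eigenvalue M (\<rho> i)"
proof -
  obtain as where as: "char_poly M = (\<Prod>a\<leftarrow>as. [:- a, 1:])" "length as = n"
    using char_poly_factorized[OF M] by auto
  have poly: "poly (char_poly M) x = (\<Prod>a\<leftarrow>as. x - a)" for x
    unfolding as(1) by (induction as) (auto simp: algebra_simps)
  have "eigenvalue M a" if "a \<in> set as" for a
    unfolding eigenvalue_root_char_poly[OF M] poly using that by (auto simp: prod_list_zero_iff)
  moreover have "det M = prod_list as"
  proof -
    have "poly (char_poly M) 0 = det (- (char_matrix M 0))" by (rule char_poly_matrix[OF M])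
    also have "- (char_matrix M 0) = (- 1) \<cdot>\<^sub>m M"
      using M by (intro eq_matI) (auto simp: char_matrix_def)
    also have "det \<dots> = (- 1) ^ n * det M" using M by (simp add: carrier_matD(2)[OF M])
    finally have "(- 1) ^ n * det M = (\<Prod>a\<leftarrow>as. - a)" by (simp add: poly)
    also have "\<dots> = (- 1) ^ n * prod_list as"
      unfolding as(2)[symmetric] by (induction as) auto
    finally show ?thesis by simp
  qed
  then have "det M = (\<Prod>i<n. as ! i)"
    by (simp add: prod.list_conv_set_nth as(2) atLeast0LessThan)
  ultimately show ?thesis using as(2) by (intro that[of "\<lambda>i. as ! i"]) auto
qed

lemma norm_prod_le_power:
  fixes f :: "nat \<Rightarrow> complex"
  assumes "\<And>i. i < n \<Longrightarrow> cmod (f i) \<le> R"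
  shows "cmod (\<Prod>i<n. f i) \<le> R ^ n"
  unfolding prod_norm[symmetric]
  using prod_mono[of "{..<n}" "\<lambda>i. cmod (f i)" "\<lambda>_. R"] assms by simp

text \<open>By Im (P z) = Re P Im z + Im P Re z, the product collects n terms with a single small
  imaginary part and other factors of modulus at most R. The hypothesis \<open>R \<ge> 1\<close>
  lets the power n - 1 of R be rounded up to n.\<close>

lemma abs_Im_prod_le:
  fixes f :: "nat \<Rightarrow> complex"
  assumes R: "R \<ge> 1" and f: "\<And>i. i < n \<Longrightarrow> cmod (f i) \<le> R" "\<And>i. i < n \<Longrightarrow> \<bar>Im (f i)\<bar> \<le> \<delta>"
  shows "\<bar>Im (\<Prod>i<n. f i)\<bar> \<le> real n * R ^ n * \<delta>"
  using f
proof (induction n)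
  case 0
  show ?case by simp
next
  case (Suc n)
  let ?P = "\<Prod>i<n. f i"
  have a: "cmod (f n) \<le> R" "\<bar>Im (f n)\<bar> \<le> \<delta>" using Suc.prems by blast+
  have IH: "\<bar>Im ?P\<bar> \<le> real n * R ^ n * \<delta>" using Suc by simp
  have P: "cmod ?P \<le> R ^ n" by (rule norm_prod_le_power) (use Suc.prems in simp)
  have d: "\<delta> \<ge> 0" and R0: "R \<ge> 0" using a(2) R by linarith+
  have Re: "\<bar>Re ?P\<bar> \<le> R ^ n" "\<bar>Re (f n)\<bar> \<le> R"
    using a(1) P abs_Re_le_cmod[of "f n"] abs_Re_le_cmod[of ?P] by linarith+
  have "\<bar>Im (?P * f n)\<bar> \<le> \<bar>Re ?P\<bar> * \<bar>Im (f n)\<bar> + \<bar>Im ?P\<bar> * \<bar>Re (f n)\<bar>"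
    unfolding times_complex.simps abs_mult[symmetric] by (rule abs_triangle_ineq)
  also have "\<dots> \<le> R ^ n * \<delta> + (real n * R ^ n * \<delta>) * R"
    using d R0 by (intro add_mono mult_mono Re IH a(2) abs_ge_zero mult_nonneg_nonneg zero_le_power) simp_all
  also have "R ^ n * \<delta> \<le> (R * R ^ n) * \<delta>"
    using mult_right_mono[OF R zero_le_power[OF R0, of n]] by (intro mult_right_mono d) simp
  also have "(R * R ^ n) * \<delta> + (real n * R ^ n * \<delta>) * R = real (Suc n) * R ^ Suc n * \<delta>"
    by (simp add: algebra_simps)
  finally show ?case by simp
qed

section \<open>The squared Bloch matrix and its eigenvalues\<close>

text \<open>On waves of multiplier y the generator exchanges \<alpha> and \<beta>: \<zeta> \<beta> =
  2 H_u \<alpha> and \<zeta> \<alpha> = - 2 H_l \<beta>. Eliminating \<beta> gives \<zeta>^2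
  \<alpha> = - 4 H_l H_u \<alpha>, and this matrix is the product H_l H_u.\<close>

definition bloch_mat :: "nat \<Rightarrow> (int \<Rightarrow> real) \<Rightarrow> (int \<Rightarrow> real) \<Rightarrow> (int \<Rightarrow> real) \<Rightarrow> complex \<Rightarrow> complex mat" where
  "bloch_mat p u l \<nu> y = hop p l (\<lambda>k. u (k - 1)) \<nu> y (1 / y) (- 1) * hop p u (\<lambda>k. l (k - 1)) \<nu> y (1 / y) (- 1)"

lemma bloch_mat_carrier: "bloch_mat p u l \<nu> y \<in> carrier_mat p p"
  by (simp add: bloch_mat_def mult_carrier_mat[of _ p p])

lemma det_bloch_mat:
  assumes "y \<noteq> 0"
  shows "det (bloch_mat p u l \<nu> y) = y ^ (2 * p) *
    (det (hop p l (\<lambda>k. u (k - 1)) \<nu> 1 ((1 / y)\<^sup>2) (- (1 / y))) * det (hop p u (\<lambda>k. l (k - 1)) \<nu> 1 ((1 / y)\<^sup>2) (- (1 / y))))"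
proof -
  have "hop p a b d y (1 / y) (- 1) = y \<cdot>\<^sub>m hop p a b d 1 ((1 / y)\<^sup>2) (- (1 / y))" for a b d
    using hop_scale[of p a b d y 1 "(1 / y)\<^sup>2" "- (1 / y)"] assms by (simp add: power2_eq_square)
  then have "det (hop p a b d y (1 / y) (- 1)) = y ^ p * det (hop p a b d 1 ((1 / y)\<^sup>2) (- (1 / y)))" for a b d
    by (simp add: carrier_matD[OF hop_carrier])
  then show ?thesis
    by (simp add: bloch_mat_def det_mult[of _ p] power_mult power2_eq_square power_mult_distrib mult_ac)
qed

text \<open>An eigenvector on one period, continued periodically and multiplied by y^k, gives
  \<alpha>; its image under the second factor gives \<beta>. The modulus exp (\<kappa> k) of y^k
  causes the growth.\<close>

lemma bloch_mat_eigenvalue_wave: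
  fixes p :: nat
  assumes p: "p > 0" and per: "\<And>k. u (k + int p) = u k" "\<And>k. l (k + int p) = l k" "\<And>k. \<nu> (k + int p) = \<nu> k"
    and \<rho>: "eigenvalue (bloch_mat p u l \<nu> y) \<rho>" and y: "cmod y = exp \<kappa>" "\<kappa> > 0"
    and \<zeta>: "\<zeta>\<^sup>2 = - 4 * \<rho>" "\<zeta> \<noteq> 0"
  obtains \<alpha> \<beta> A j where "bloch_wave u l \<nu> \<zeta> \<alpha> \<beta>" "\<alpha> j \<noteq> 0"
    "\<And>k. cmod (\<alpha> k) \<le> A * exp (\<kappa> * of_int \<bar>k\<bar>)" "\<And>k. cmod (\<beta> k) \<le> A * exp (\<kappa> * of_int \<bar>k\<bar>)"
    "0 \<le> j" "j < int p"
proof -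
  have y0: "y \<noteq> 0" using y by auto
  obtain \<phi> where \<phi>: "\<phi> \<in> carrier_vec p" "\<phi> \<noteq> 0\<^sub>v p" "bloch_mat p u l \<nu> y *\<^sub>v \<phi> = \<rho> \<cdot>\<^sub>v \<phi>"
    using \<rho> carrier_matD(1)[OF bloch_mat_carrier] unfolding eigenvalue_def eigenvector_def by auto
  define \<psi> where "\<psi> = hop p u (\<lambda>k. l (k - 1)) \<nu> y (1 / y) (- 1) *\<^sub>v \<phi>"
  have \<psi>: "\<psi> \<in> carrier_vec p" unfolding \<psi>_def by (rule mult_mat_vec_carrier[OF hop_carrier \<phi>(1)])
  have \<psi>': "hop p l (\<lambda>k. u (k - 1)) \<nu> y (1 / y) (- 1) *\<^sub>v \<psi> = \<rho> \<cdot>\<^sub>v \<phi>"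
    using \<phi>(3) unfolding bloch_mat_def \<psi>_def by (simp add: assoc_mult_mat_vec[of _ p p _ p] \<phi>(1))
  define r where "r k = nat (k mod int p)" for k
  have r: "r k < p" for k using p by (simp add: r_def nat_less_iff)
  have int_r: "int (r k) = k mod int p" for k using p by (simp add: r_def)
  have r1: "r (k + 1) = (r k + 1) mod p" for k
  proof -
    have "int (r (k + 1)) = int ((r k + 1) mod p)"
      unfolding int_r zmod_int of_nat_add by (simp add: int_r mod_simps)
    then show ?thesis by simp
  qed
  have r2: "r (k - 1) = (r k + p - 1) mod p" for k
  proof -
    have "int (r k + p - 1) = int (r k) + int p - 1" using p by simp
    then have "int ((r k + p - 1) mod p) = (k mod int p + int p - 1) mod int p"
      unfolding zmod_int by (simp add: int_r)
    also have "\<dots> = (k - 1) mod int p" by (metis add_diff_eq diff_add_eq mod_add_self2 mod_diff_left_eq)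
    finally show ?thesis using int_r[of "k - 1"] by linarith
  qed
  have periodic: "f (int (r k)) = f k" if "\<And>k. f (k + int p) = f k" for f :: "int \<Rightarrow> real" and k
    unfolding int_r using that by (intro periodic_fun_simple_mod) (simp add: periodic_fun_simple_def)
  have pu1: "u (int (r k) - 1) = u (k - 1)" "l (int (r k) - 1) = l (k - 1)" for k
    using periodic[of "\<lambda>k. u (k - 1)" k] periodic[of "\<lambda>k. l (k - 1)" k] per(1,2)[of "_ - 1"]
    by (simp_all add: algebra_simps)
  define \<alpha> where "\<alpha> k = y powi k * \<phi> $ r k" for k
  \<comment> \<open>Forced by the first wave equation, \<zeta> \<beta> k = 2 y^k \<psi> k; this is
    where \<open>\<zeta> \<noteq> 0\<close> is needed.\<close>
  define \<beta> where "\<beta> k = (2 / \<zeta>) * (y powi k * \<psi> $ r k)" for k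
  have yp: "y powi (k + 1) = y * y powi k" "y powi (k - 1) = (1 / y) * y powi k" for k
    using y0 by (simp_all add: power_int_add_1' power_int_diff)
  have e1: "\<psi> $ r k = u k * y * \<phi> $ r (k + 1) + l (k - 1) * (1 / y) * \<phi> $ r (k - 1) + \<nu> k * (- 1) * \<phi> $ r k" for k
    unfolding \<psi>_def hop_mult_vec[OF r \<phi>(1)] r1 r2 by (simp add: pu1 periodic per)
  have e2: "\<rho> * \<phi> $ r k = l k * y * \<psi> $ r (k + 1) + u (k - 1) * (1 / y) * \<psi> $ r (k - 1) + \<nu> k * (- 1) * \<psi> $ r k" for k
  proof -
    have "\<rho> * \<phi> $ r k = (\<rho> \<cdot>\<^sub>v \<phi>) $ r k" using r[of k] \<phi>(1) by simp
    then show ?thesis unfolding \<psi>'[symmetric] hop_mult_vec[OF r \<psi>] r1 r2 by (simp add: pu1 periodic per)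
  qed
  have bw: "bloch_wave u l \<nu> \<zeta> \<alpha> \<beta>"
    unfolding bloch_wave_def
  proof (intro allI conjI)
    fix k
    have "\<zeta> * \<beta> k = 2 * (y powi k * \<psi> $ r k)" using \<zeta>(2) by (simp add: \<beta>_def)
    then show "\<zeta> * \<beta> k = 2 * (u k * \<alpha> (k + 1) + l (k - 1) * \<alpha> (k - 1) - \<nu> k * \<alpha> k)"
      unfolding e1 \<alpha>_def yp by (simp add: algebra_simps)
    have "- 2 * (u (k - 1) * \<beta> (k - 1) + l k * \<beta> (k + 1) - \<nu> k * \<beta> k) =
        - (4 / \<zeta>) * y powi k * (\<rho> * \<phi> $ r k)"
      unfolding e2 \<beta>_def yp by (simp add: algebra_simps)
    also have "\<dots> = (- (4 / \<zeta>) * \<rho>) * (y powi k * \<phi> $ r k)" by simp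
    also have "- (4 / \<zeta>) * \<rho> = \<zeta>" using \<zeta> by (simp add: field_simps power2_eq_square)
    finally show "\<zeta> * \<alpha> k = - 2 * (u (k - 1) * \<beta> (k - 1) + l k * \<beta> (k + 1) - \<nu> k * \<beta> k)"
      by (simp add: \<alpha>_def)
  qed
  have "\<exists>i<p. \<phi> $ i \<noteq> 0"
  proof (rule ccontr)
    assume "\<not> ?thesis"
    then have "\<phi> = 0\<^sub>v p" using \<phi>(1) by (intro eq_vecI) auto
    with \<phi>(2) show False by simp
  qed
  then obtain i where i: "i < p" "\<phi> $ i \<noteq> 0" by blast
  then have "r (int i) = i" by (simp add: r_def)
  then have nz: "\<alpha> (int i) \<noteq> 0" using i y0 by (simp add: \<alpha>_def)
  have yk: "cmod (y powi k) \<le> exp (\<kappa> * of_int \<bar>k\<bar>)" for k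
  proof -
    have "cmod (y powi k) = exp (\<kappa> * of_int k)" by (simp add: norm_power_int y(1) exp_power_int)
    also have "\<dots> \<le> exp (\<kappa> * of_int \<bar>k\<bar>)" using y(2) by simp
    finally show ?thesis .
  qed
  define A where "A = (\<Sum>i<p. cmod (\<phi> $ i)) + cmod (2 / \<zeta>) * (\<Sum>i<p. cmod (\<psi> $ i))"
  have s: "cmod (\<phi> $ r k) \<le> (\<Sum>i<p. cmod (\<phi> $ i))" "cmod (\<psi> $ r k) \<le> (\<Sum>i<p. cmod (\<psi> $ i))" for k
    using r[of k] by (auto intro!: member_le_sum)
  have A1: "(\<Sum>i<p. cmod (\<phi> $ i)) \<le> A" "cmod (2 / \<zeta>) * (\<Sum>i<p. cmod (\<psi> $ i)) \<le> A"
    by (auto simp: A_def intro!: sum_nonneg mult_nonneg_nonneg divide_nonneg_nonneg)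
  have "cmod (\<alpha> k) \<le> A * exp (\<kappa> * of_int \<bar>k\<bar>)" for k
    unfolding \<alpha>_def norm_mult mult.commute[of A]
    using s(1)[of k] A1 by (intro mult_mono yk) auto
  moreover have "cmod (\<beta> k) \<le> A * exp (\<kappa> * of_int \<bar>k\<bar>)" for k
  proof -
    have "cmod (\<beta> k) = cmod (y powi k) * (cmod (2 / \<zeta>) * cmod (\<psi> $ r k))"
      by (simp add: \<beta>_def norm_mult norm_divide)
    also have "\<dots> \<le> exp (\<kappa> * of_int \<bar>k\<bar>) * A"
      using s(2)[of k] A1 by (intro mult_mono yk order_trans[OF mult_left_mono[OF s(2)] A1(2)]) auto
    finally show ?thesis by (simp add: mult.commute)
  qed
  ultimately show ?thesis using that[OF bw nz] i by auto
qed

text \<open>A row of either factor receives three contributions of modulus at most B Y, also when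
  some of them share a position, so each factor stretches the maximum norm by at most 3 B Y.\<close>

lemma bloch_mat_eigenvalue_le:
  fixes p :: nat
  assumes p: "p > 0" and \<rho>: "eigenvalue (bloch_mat p u l \<nu> y) \<rho>"
    and B: "\<And>k. \<bar>u k\<bar> \<le> B" "\<And>k. \<bar>l k\<bar> \<le> B" "\<And>k. \<bar>\<nu> k\<bar> \<le> B" and Y: "cmod y \<le> Y" "cmod (1 / y) \<le> Y" "1 \<le> Y"
  shows "cmod \<rho> \<le> (3 * B * Y)\<^sup>2"
proof -
  have B0: "B \<ge> 0" using B(1)[of 0] by linarith
  obtain \<phi> where \<phi>: "\<phi> \<in> carrier_vec p" "\<phi> \<noteq> 0\<^sub>v p" "bloch_mat p u l \<nu> y *\<^sub>v \<phi> = \<rho> \<cdot>\<^sub>v \<phi>"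
    using \<rho> carrier_matD(1)[OF bloch_mat_carrier] unfolding eigenvalue_def eigenvector_def by auto
  have bound: "cmod ((hop p a b d y (1 / y) (- 1) *\<^sub>v w) $ i) \<le> 3 * B * Y * W"
    if "i < p" "w \<in> carrier_vec p" "\<And>i. i < p \<Longrightarrow> cmod (w $ i) \<le> W"
      "\<And>k. \<bar>a k\<bar> \<le> B" "\<And>k. \<bar>b k\<bar> \<le> B" "\<And>k. \<bar>d k\<bar> \<le> B" for a b d w W i
  proof -
    have W: "W \<ge> 0" using that(3)[OF that(1)] norm_ge_zero order_trans by blast
    have "cmod (of_real (a (int i)) * y * w $ ((i + 1) mod p)) \<le> B * Y * W"
      "cmod (of_real (b (int i)) * (1 / y) * w $ ((i + p - 1) mod p)) \<le> B * Y * W"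
      unfolding norm_mult norm_of_real using that p B0 W Y by (auto intro!: mult_mono)
    moreover have "B * 1 \<le> B * Y" using B0 Y by (intro mult_left_mono) auto
    then have "\<bar>d (int i)\<bar> \<le> B * Y" using that(6)[of "int i"] by linarith
    then have "cmod (of_real (d (int i)) * (- 1) * w $ i) \<le> B * Y * W"
      unfolding norm_mult norm_of_real using that(1,3) W by (auto intro!: mult_mono)
    ultimately show ?thesis
      unfolding hop_mult_vec[OF that(1,2)]
      by (intro order_trans[OF norm_triangle_ineq] order_trans[OF add_mono[OF norm_triangle_ineq order_refl]]) linarith
  qed
  \<comment> \<open>The eigenvalue equation is evaluated where the eigenvector attains its maximum
    norm.\<close>
  define W where "W = Max ((\<lambda>i. cmod (\<phi> $ i)) ` {..<p})"
  have W: "cmod (\<phi> $ i) \<le> W" if "i < p" for i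
    unfolding W_def using that by (intro Max_ge) auto
  have "W \<in> (\<lambda>i. cmod (\<phi> $ i)) ` {..<p}" unfolding W_def using p by (intro Max_in) auto
  then obtain i where i: "i < p" "W = cmod (\<phi> $ i)" by auto
  have "W > 0"
  proof (rule ccontr)
    assume "\<not> W > 0"
    then have "\<phi> $ i = 0" if "i < p" for i
      using W[OF that] norm_ge_zero[of "\<phi> $ i"] by (metis norm_le_zero_iff order_trans not_less)
    then have "\<phi> = 0\<^sub>v p" using \<phi>(1) by (intro eq_vecI) auto
    with \<phi>(2) show False by simp
  qed
  define \<psi> where "\<psi> = hop p u (\<lambda>k. l (k - 1)) \<nu> y (1 / y) (- 1) *\<^sub>v \<phi>"
  have \<psi>: "\<psi> \<in> carrier_vec p" unfolding \<psi>_def by (rule mult_mat_vec_carrier[OF hop_carrier \<phi>(1)])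
  have \<psi>': "hop p l (\<lambda>k. u (k - 1)) \<nu> y (1 / y) (- 1) *\<^sub>v \<psi> = \<rho> \<cdot>\<^sub>v \<phi>"
    using \<phi>(3) unfolding bloch_mat_def \<psi>_def by (simp add: assoc_mult_mat_vec[of _ p p _ p] \<phi>(1))
  have 1: "cmod (\<psi> $ i) \<le> 3 * B * Y * W" if "i < p" for i
    unfolding \<psi>_def by (rule bound[OF that \<phi>(1) W]) (use B in auto)
  have "cmod ((\<rho> \<cdot>\<^sub>v \<phi>) $ i) \<le> 3 * B * Y * (3 * B * Y * W)"
    unfolding \<psi>'[symmetric] by (rule bound[OF i(1) \<psi> 1]) (use B in auto)
  also have "(\<rho> \<cdot>\<^sub>v \<phi>) $ i = \<rho> * \<phi> $ i" using i \<phi>(1) by simp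
  finally have "cmod \<rho> * W \<le> (3 * B * Y)\<^sup>2 * W"
    by (simp add: norm_mult i(2)[symmetric] power2_eq_square mult_ac)
  then show ?thesis using \<open>W > 0\<close> by simp
qed

no_notation vec_index (infixl "$" 100)
notation vec_nth (infixl "$" 90)

section \<open>Holomorphic functions with small imaginary part near the circle\<close>

text \<open>The factor K is fixed while v and \<kappa>1 may change with v0. The bound forces D to be
  a constant c on the unit circle, so J e = c e^q there and hence everywhere, and q > 0 gives J 0 =
  0.\<close>

lemma eq_0_if_Im_bounded_on_annuli:
  assumes J: "J holomorphic_on UNIV" and q: "q > 0" and K: "K \<ge> 0"
    and D: "\<And>y. y \<noteq> 0 \<Longrightarrow> D y = y ^ q * J (1 / y)"
    and bound: "\<And>v0. v0 > 0 \<Longrightarrow> \<exists>v<v0. \<exists>\<kappa>1>0. \<forall>\<kappa> y. 0 < \<kappa> \<longrightarrow> \<kappa> < \<kappa>1 \<longrightarrow> cmod y = exp \<kappa> \<longrightarrow>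
      \<bar>Im (D y)\<bar> \<le> K * \<kappa> * v"
  shows "J 0 = 0"
proof -
  \<comment> \<open>In the coordinate y = exp (i w) the unit circle is the real axis and the circle
    of radius exp \<kappa> is the line Im w = - \<kappa>.\<close>
  define g where "g w = exp (\<i> * of_nat q * w) * J (exp (- \<i> * w))" for w
  have gD: "g w = D (exp (\<i> * w))" for w
    by (simp add: g_def D exp_of_nat_mult[symmetric] exp_minus field_simps)
  have "(\<lambda>w. J (exp (- \<i> * w))) holomorphic_on UNIV"
    using holomorphic_on_compose[of "\<lambda>w. exp (- \<i> * w)" UNIV J] holomorphic_on_subset[OF J subset_UNIV]
    by (simp add: o_def holomorphic_intros)
  then have g: "g holomorphic_on UNIV"
    unfolding g_def by (intro holomorphic_intros) auto
  have gd: "(g has_field_derivative deriv g w) (at w)" for w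
    using holomorphic_derivI[OF g, of w] by simp
  have real_zero: "Im (g (of_real \<theta>)) = 0" and Re_zero: "Re (deriv g (of_real \<theta>)) = 0" for \<theta>
  proof -
    \<comment> \<open>The imaginary part along the normal to the circle at angle \<theta>. Its
      derivative at 0 is Im (- i g') = - Re g', which is how the Cauchy-Riemann equations
      enter.\<close>
    define \<phi> where "\<phi> \<kappa> = Im (g (of_real \<theta> - \<i> * of_real \<kappa>))" for \<kappa>
    let ?d = "deriv g (of_real \<theta>)"
    have "((\<lambda>z. g (of_real \<theta> - \<i> * z)) has_field_derivative ?d * (- \<i>)) (at (of_real 0))"
      by (rule DERIV_chain'[where g = g]) (auto intro!: derivative_eq_intros gd)
    from bounded_linear.has_vector_derivative[OF bounded_linear_Im has_vector_derivative_real_field[OF this]]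
    have \<phi>d: "(\<phi> has_real_derivative - Re ?d) (at 0)"
      unfolding \<phi>_def[abs_def] has_real_derivative_iff_has_vector_derivative by simp
    have ex: "\<exists>v<v0. eventually (\<lambda>\<kappa>. \<bar>\<phi> \<kappa>\<bar> \<le> K * \<kappa> * v) (at_right 0)" if v0: "v0 > 0" for v0
    proof -
      obtain v \<kappa>1 where v: "v < v0" "\<kappa>1 > 0" and
        b: "\<And>\<kappa> y. 0 < \<kappa> \<Longrightarrow> \<kappa> < \<kappa>1 \<Longrightarrow> cmod y = exp \<kappa> \<Longrightarrow> \<bar>Im (D y)\<bar> \<le> K * \<kappa> * v"
        using bound[OF v0] by blast
      have "\<bar>\<phi> \<kappa>\<bar> \<le> K * \<kappa> * v" if "\<kappa> \<in> {0<..<\<kappa>1}" for \<kappa>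
        unfolding \<phi>_def gD using that by (intro b) (auto simp: algebra_simps)
      then have "eventually (\<lambda>\<kappa>. \<bar>\<phi> \<kappa>\<bar> \<le> K * \<kappa> * v) (at_right 0)"
        using eventually_at_right_real[OF v(2)] by (rule eventually_mono[rotated])
      with v show ?thesis by blast
    qed
    have "\<phi> 0 = 0"
    proof -
      obtain v where "eventually (\<lambda>\<kappa>. \<bar>\<phi> \<kappa>\<bar> \<le> K * \<kappa> * v) (at_right 0)" using ex[of 1] by auto
      moreover have "((\<lambda>\<kappa>. K * \<kappa> * v) \<longlongrightarrow> 0) (at_right 0)"
        by (auto intro!: tendsto_eq_intros)
      ultimately have "(\<phi> \<longlongrightarrow> 0) (at_right 0)"
        by (intro Lim_null_comparison[of \<phi>]) auto
      moreover have "(\<phi> \<longlongrightarrow> \<phi> 0) (at_right 0)"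
        using DERIV_isCont[OF \<phi>d] unfolding isCont_def by (rule tendsto_mono[OF at_le, rotated]) simp
      ultimately show ?thesis using tendsto_unique[OF trivial_limit_at_right_real] by blast
    qed
    then show "Im (g (of_real \<theta>)) = 0" by (simp add: \<phi>_def)
    have lim: "((\<lambda>\<kappa>. \<bar>\<phi> \<kappa> / \<kappa>\<bar>) \<longlongrightarrow> \<bar>- Re ?d\<bar>) (at_right 0)"
      using has_field_derivative_at_within[OF \<phi>d, of "{0<..}"] \<open>\<phi> 0 = 0\<close>
      unfolding has_field_derivative_iff by (intro tendsto_rabs) simp
    have "\<bar>Re ?d\<bar> \<le> 0 + e" if e: "e > 0" for e
    proof -
      \<comment> \<open>Dividing by K + 1 instead of K also covers K = 0.\<close>
      obtain v where v: "v < e / (K + 1)" "eventually (\<lambda>\<kappa>. \<bar>\<phi> \<kappa>\<bar> \<le> K * \<kappa> * v) (at_right 0)"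
        using ex[of "e / (K + 1)"] e K by auto
      have "eventually (\<lambda>\<kappa>. \<bar>\<phi> \<kappa> / \<kappa>\<bar> \<le> K * v) (at_right 0)"
        using v(2) eventually_at_right_less[of 0]
        by eventually_elim (simp add: field_simps)
      then have "\<bar>- Re ?d\<bar> \<le> K * v"
        by (intro tendsto_upperbound[OF lim]) auto
      also have "\<dots> \<le> K * (e / (K + 1))" using v(1) K by (intro mult_left_mono) auto
      also have "\<dots> \<le> e" using K e by (simp add: field_simps)
      finally show ?thesis by simp
    qed
    then have "\<bar>Re ?d\<bar> \<le> 0" by (rule field_le_epsilon)
    then show "Re ?d = 0" by simp
  qed
  have vd: "((\<lambda>x. g (of_real x)) has_vector_derivative deriv g (of_real \<theta>)) (at \<theta>)" for \<theta>
    by (rule has_vector_derivative_real_field[OF gd])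
  have "deriv g (of_real \<theta>) = 0" for \<theta>
  proof (rule complex_eqI)
    have "((\<lambda>x. Im (g (of_real x))) has_real_derivative Im (deriv g (of_real \<theta>))) (at \<theta>)"
      using bounded_linear.has_vector_derivative[OF bounded_linear_Im vd]
      unfolding has_real_derivative_iff_has_vector_derivative by simp
    then show "Im (deriv g (of_real \<theta>)) = Im 0"
      unfolding real_zero using DERIV_unique[OF _ DERIV_const[of "0 :: real"]] by auto
  qed (simp add: Re_zero)
  then obtain c where c: "g (of_real x) = c" for x
    using has_vector_derivative_zero_constant[OF convex_UNIV, of "\<lambda>x. g (of_real x)"] vd by auto
  \<comment> \<open>Identity theorem: the difference is entire and vanishes on the unit circle, in
    which 1 is a limit point.\<close>
  have "J 0 - c * 0 ^ q = 0"
  proof (rule analytic_continuation[of "\<lambda>e. J e - c * e ^ q" UNIV "sphere 0 1" 1])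
    show "(1 :: complex) islimpt sphere 0 1"
    proof (rule connected_imp_perfect)
      show "connected (sphere (0 :: complex) 1)" by (rule connected_sphere) simp
      have "- 1 \<in> sphere (0 :: complex) 1" "1 \<in> sphere (0 :: complex) 1" by auto
      then show "sphere (0 :: complex) 1 \<noteq> {x}" for x by (metis neg_equal_iff_equal one_neq_neg_one singletonD)
    qed simp
    fix e :: complex assume "e \<in> sphere 0 1"
    then have "exp (\<i> * of_real (Arg2pi e)) = e" using complex_norm_eq_1_exp[of e] by simp
    then obtain x where x: "e = exp (- \<i> * of_real x)"
      using that[of "- Arg2pi e"] by (metis mult_minus_left mult_minus_right of_real_minus minus_minus)
    have "exp (\<i> * of_nat q * of_real x) * J e = c" using c[of x] by (simp add: g_def x)
    moreover have "exp (\<i> * of_nat q * of_real x) * e ^ q = 1"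
      unfolding x exp_of_nat_mult[symmetric] exp_add[symmetric] by (simp add: algebra_simps)
    ultimately have "exp (\<i> * of_nat q * of_real x) * (J e - c * e ^ q) = 0"
      by (simp add: algebra_simps)
    then show "J e - c * e ^ q = 0" by simp
  qed (auto intro!: holomorphic_intros J)
  then show ?thesis using q by simp
qed

section \<open>Heisenberg evolution\<close>

lemma op_mult_assoc:
  assumes "finite S"
  shows "op_mult S (op_mult S A B) C = op_mult S A (op_mult S B C)"
  by (intro ext) (simp add: op_mult_def sum_distrib_left sum_distrib_right mult.assoc, rule sum.swap)

lemma op_mult_one_right:
  assumes "finite S" "A \<in> alg S"
  shows "op_mult S A (op_one S) = A"
proof (intro ext)
  fix s s'
  have "op_mult S A (op_one S) s s' = (\<Sum>r\<in>confs S. if r = s' then A s s' else 0)"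
    unfolding op_mult_def by (intro sum.cong) (auto simp: op_one_eq[OF assms(1)])
  then show "op_mult S A (op_one S) s s' = A s s'"
    using assms by (auto simp: finite_confs alg_def)
qed

lemma op_mult_one_left:
  assumes "finite S" "A \<in> alg S"
  shows "op_mult S (op_one S) A = A"
proof (intro ext)
  fix s s'
  have "op_mult S (op_one S) A s s' = (\<Sum>r\<in>confs S. if r = s then A s s' else 0)"
    unfolding op_mult_def using assms(2)
    by (intro sum.cong) (auto simp: op_one_eq[OF assms(1)] alg_def)
  then show "op_mult S (op_one S) A s s' = A s s'"
    using assms by (auto simp: finite_confs alg_def)
qed

lemma op_power_commute:
  assumes "finite S" "A \<in> alg S"
  shows "op_mult S (op_power S A k) A = op_mult S A (op_power S A k)"
  by (induction k) (simp_all add: assms op_mult_one_left op_mult_one_right op_mult_assoc)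

lemma op_mult_scale_left: "op_mult S (op_scale c A) B = op_scale c (op_mult S A B)"
  by (intro ext) (simp add: op_mult_def op_scale_def sum_distrib_left mult_ac)

lemma op_mult_scale_right: "op_mult S A (op_scale c B) = op_scale c (op_mult S A B)"
  by (intro ext) (simp add: op_mult_def op_scale_def sum_distrib_left mult_ac)

lemma op_power_scale: "op_power S (op_scale c A) k = op_scale (c ^ k) (op_power S A k)"
  by (induction k)
     (simp_all add: op_mult_scale_left op_mult_scale_right, simp_all add: op_scale_def mult_ac)

text \<open>The sum of the moduli of all entries dominates every row sum, so it bounds entries of
  powers geometrically; this is all that the exponential series needs.\<close>

lemma op_power_bound:
  assumes "finite S" "A \<in> alg S"
  shows "cmod (op_power S A k s s') \<le> (\<Sum>r\<in>confs S. \<Sum>r'\<in>confs S. cmod (A r r')) ^ k"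
    (is "_ \<le> ?M ^ k")
proof (induction k arbitrary: s)
  case 0
  show ?case by (simp add: op_one_eq[OF assms(1)])
next
  case (Suc k)
  have nn: "0 \<le> ?M" by (intro sum_nonneg) auto
  have row: "(\<Sum>r\<in>confs S. cmod (A s r)) \<le> ?M"
  proof (cases "s \<in> confs S")
    case True
    then show ?thesis
      using assms(1) by (intro member_le_sum[of s "confs S" "\<lambda>r. \<Sum>r'\<in>confs S. cmod (A r r')"])
        (auto intro: sum_nonneg simp: finite_confs)
  next
    case False
    then show ?thesis using assms(2) nn by (simp add: alg_def)
  qed
  have "cmod (op_power S A (Suc k) s s') \<le> (\<Sum>r\<in>confs S. cmod (A s r) * cmod (op_power S A k r s'))"
    by (simp add: op_mult_def order_trans[OF norm_sum] norm_mult)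
  also have "\<dots> \<le> (\<Sum>r\<in>confs S. cmod (A s r) * ?M ^ k)"
    by (intro sum_mono mult_left_mono Suc.IH) auto
  also have "\<dots> \<le> ?M * ?M ^ k"
    unfolding sum_distrib_right[symmetric] by (intro mult_right_mono row) (simp add: nn)
  finally show ?case by simp
qed

text \<open>Every matrix entry is a power series in z, so continuity and termwise differentiation
  come from scalar power series.\<close>

lemma op_exp_scale_eq:
  "op_exp S (op_scale z H) s s' = (\<Sum>k. (op_power S H k s s' / fact k) * z ^ k)"
  by (simp add: op_exp_def op_power_scale op_scale_def mult_ac)

lemma summable_op_exp:
  assumes "finite S" "H \<in> alg S"
  shows "summable (\<lambda>k. (op_power S H k s s' / fact k) * z ^ k)"
proof -
  define M where "M = (\<Sum>r\<in>confs S. \<Sum>r'\<in>confs S. cmod (H r r'))"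
  show ?thesis
  proof (rule summable_comparison_test')
    show "summable (\<lambda>k. (M * cmod z) ^ k /\<^sub>R fact k)" by (rule summable_exp_generic)
    fix k
    show "norm ((op_power S H k s s' / fact k) * z ^ k) \<le> (M * cmod z) ^ k /\<^sub>R fact k"
      using op_power_bound[OF assms, of k s s']
      by (simp add: norm_mult norm_divide norm_power power_mult_distrib divide_simps mult_right_mono M_def)
  qed
qed

lemma op_exp_scale_0: "op_exp S (op_scale 0 H) = op_one S"
proof (intro ext)
  fix s s'
  show "op_exp S (op_scale 0 H) s s' = op_one S s s'"
    using powser_zero[of "\<lambda>k. op_power S H k s s' / fact k"] by (simp add: op_exp_scale_eq)
qed

lemma op_exp_deriv_left:
  assumes "finite S" "H \<in> alg S"
  shows "((\<lambda>z. op_exp S (op_scale z H) s s') has_field_derivative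
           op_mult S H (op_exp S (op_scale z H)) s s') (at z)"
proof -
  let ?c = "\<lambda>s k. op_power S H k s s' / fact k"
  have "diffs (?c s) k * z ^ k = (\<Sum>r\<in>confs S. H s r * (?c r k * z ^ k))" for k
    by (simp add: diffs_def op_mult_def sum_divide_distrib sum_distrib_right sum_distrib_left divide_simps mult.assoc del: of_nat_Suc)
  then have "(\<Sum>k. diffs (?c s) k * z ^ k) = (\<Sum>k. \<Sum>r\<in>confs S. H s r * (?c r k * z ^ k))"
    by simp
  also have "\<dots> = (\<Sum>r\<in>confs S. \<Sum>k. H s r * (?c r k * z ^ k))"
    by (intro suminf_sum summable_mult summable_op_exp assms)
  also have "\<dots> = op_mult S H (op_exp S (op_scale z H)) s s'"
    unfolding op_mult_def op_exp_scale_eq by (intro sum.cong refl suminf_mult summable_op_exp assms)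
  finally show ?thesis
    using termdiffs_strong_converges_everywhere[of "?c s" z, OF summable_op_exp[OF assms]]
    by (simp add: op_exp_scale_eq)
qed

lemma op_exp_commute:
  assumes "finite S" "H \<in> alg S"
  shows "op_mult S H (op_exp S (op_scale z H)) = op_mult S (op_exp S (op_scale z H)) H"
proof (intro ext)
  fix s s'
  have "op_mult S H (op_exp S (op_scale z H)) s s' =
      (\<Sum>r\<in>confs S. \<Sum>k. H s r * ((op_power S H k r s' / fact k) * z ^ k))"
    unfolding op_mult_def op_exp_scale_eq
    by (intro sum.cong refl suminf_mult[symmetric] summable_op_exp assms)
  also have "\<dots> = (\<Sum>k. \<Sum>r\<in>confs S. H s r * ((op_power S H k r s' / fact k) * z ^ k))"
    by (intro suminf_sum[symmetric] summable_mult summable_op_exp assms)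
  also have "\<dots> = (\<Sum>k. op_mult S H (op_power S H k) s s' / fact k * z ^ k)"
    by (simp add: op_mult_def sum_distrib_right sum_divide_distrib mult.assoc)
  also have "\<dots> = (\<Sum>k. op_mult S (op_power S H k) H s s' / fact k * z ^ k)"
    by (simp add: op_power_commute assms)
  also have "\<dots> = (\<Sum>k. \<Sum>r\<in>confs S. ((op_power S H k s r / fact k) * z ^ k) * H r s')"
    by (simp add: op_mult_def sum_distrib_left sum_distrib_right sum_divide_distrib mult_ac)
  also have "\<dots> = (\<Sum>r\<in>confs S. \<Sum>k. ((op_power S H k s r / fact k) * z ^ k) * H r s')"
    by (intro suminf_sum summable_mult2 summable_op_exp assms)
  also have "\<dots> = op_mult S (op_exp S (op_scale z H)) H s s'"
    unfolding op_mult_def op_exp_scale_eq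
    by (intro sum.cong refl suminf_mult2[symmetric] summable_op_exp assms)
  finally show "op_mult S H (op_exp S (op_scale z H)) s s' = op_mult S (op_exp S (op_scale z H)) H s s'" .
qed

lemma op_exp_deriv_right:
  assumes "finite S" "H \<in> alg S"
  shows "((\<lambda>z. op_exp S (op_scale z H) s s') has_field_derivative
           op_mult S (op_exp S (op_scale z H)) H s s') (at z)"
  using op_exp_deriv_left[OF assms] by (simp add: op_exp_commute assms)

lemma op_mult_deriv:
  assumes "\<And>s s'. ((\<lambda>z. A z s s') has_field_derivative A' s s') (at z)"
    and "\<And>s s'. ((\<lambda>z. B z s s') has_field_derivative B' s s') (at z)"
  shows "((\<lambda>z. op_mult S (A z) (B z) s s') has_field_derivative
      op_mult S A' (B z) s s' + op_mult S (A z) B' s s') (at z)"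
  unfolding op_mult_def
  by (rule DERIV_cong[OF DERIV_sum[OF DERIV_mult[OF assms]]]) (simp add: sum.distrib mult_ac)


section \<open>Complex-time evolution and the normalized trace\<close>

text \<open>Time is complex, so that derivatives are complex ones; z = i t is the Heisenberg
  evolution.\<close>

definition heis :: "int set \<Rightarrow> opr \<Rightarrow> complex \<Rightarrow> opr \<Rightarrow> opr" where
  "heis S H z A = op_mult S (op_mult S (op_exp S (op_scale z H)) A) (op_exp S (op_scale (- z) H))"

definition ntrace :: "int set \<Rightarrow> opr \<Rightarrow> complex" where
  "ntrace S A = (\<Sum>s\<in>confs S. A s s) / of_nat (card (confs S))"

lemma xy_evolution_eq_heis:
  "xy_evolution \<mu> \<gamma> \<nu> m n t A = heis {m..n} (xy_hamiltonian \<mu> \<gamma> \<nu> m n) (\<i> * of_real t) A"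
  by (simp add: xy_evolution_def heis_def Let_def)

lemma ntrace_mult_commute: "ntrace S (op_mult S A B) = ntrace S (op_mult S B A)"
proof -
  have "(\<Sum>s\<in>confs S. \<Sum>r\<in>confs S. A s r * B r s) = (\<Sum>r\<in>confs S. \<Sum>s\<in>confs S. A s r * B r s)"
    by (rule sum.swap)
  then show ?thesis by (simp add: ntrace_def op_mult_def mult.commute)
qed

text \<open>Cyclicity of the trace moves the evolution to the other factor and reverses
  time.\<close>

lemma ntrace_heis:
  assumes "finite S"
  shows "ntrace S (op_mult S W (heis S H z A)) = ntrace S (op_mult S (heis S H (- z) W) A)"
proof -
  let ?E = "\<lambda>z. op_exp S (op_scale z H)"
  have "ntrace S (op_mult S W (heis S H z A)) =
      ntrace S (op_mult S (op_mult S W (op_mult S (?E z) A)) (?E (- z)))"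
    by (simp add: heis_def op_mult_assoc assms)
  also have "\<dots> = ntrace S (op_mult S (?E (- z)) (op_mult S W (op_mult S (?E z) A)))"
    by (rule ntrace_mult_commute)
  finally show ?thesis by (simp add: heis_def op_mult_assoc assms)
qed

lemma heis_0:
  assumes "finite S" "A \<in> alg S"
  shows "heis S H 0 A = A"
  using assms by (simp add: heis_def op_exp_scale_0 op_mult_one_left op_mult_one_right)

lemma heis_deriv:
  assumes "finite S" "H \<in> alg S"
  shows "((\<lambda>z. heis S H z A s s') has_field_derivative op_commutator S H (heis S H z A) s s') (at z)"
proof -
  let ?E = "\<lambda>z. op_exp S (op_scale z H)"
  have 1: "((\<lambda>z. op_mult S (?E z) A s s') has_field_derivative
      op_mult S (op_mult S H (?E z)) A s s' + op_mult S (?E z) (\<lambda>_ _. 0) s s') (at z)" for s s'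
    by (rule op_mult_deriv) (auto intro!: op_exp_deriv_left assms)
  have 2: "((\<lambda>z. ?E (- z) s s') has_field_derivative - op_mult S (?E (- z)) H s s') (at z)" for s s'
    using DERIV_chain'[OF DERIV_minus[OF DERIV_ident] op_exp_deriv_right[OF assms, of s s' "- z"]] by simp
  have "((\<lambda>z. heis S H z A s s') has_field_derivative
     op_mult S (\<lambda>s s'. op_mult S (op_mult S H (?E z)) A s s' + op_mult S (?E z) (\<lambda>_ _. 0) s s') (?E (- z)) s s' +
     op_mult S (op_mult S (?E z) A) (\<lambda>s s'. - op_mult S (?E (- z)) H s s') s s') (at z)"
    unfolding heis_def by (intro op_mult_deriv 1 2)
  moreover have "op_mult S (\<lambda>s s'. op_mult S (op_mult S H (?E z)) A s s' + op_mult S (?E z) (\<lambda>_ _. 0) s s') (?E (- z)) s s'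
     = op_mult S H (heis S H z A) s s'"
    using op_mult_assoc[OF assms(1)] by (simp add: heis_def op_mult_def[of S _ "\<lambda>_ _. 0"])
  moreover have "op_mult S (op_mult S (?E z) A) (\<lambda>s s'. - op_mult S (?E (- z)) H s s') s s'
     = - op_mult S (heis S H z A) H s s'"
    unfolding heis_def op_mult_assoc[OF assms(1)]
    unfolding op_mult_def[of S A "\<lambda>s s'. - X s s'" for X] op_mult_def[of S A "op_mult S X Y" for X Y]
      op_mult_def[of S "?E z"]
    by (simp add: sum_negf)
  ultimately show ?thesis by (simp add: op_commutator_def)
qed

lemma ntrace_commutator:
  assumes "finite S"
  shows "ntrace S (op_mult S X (op_commutator S H A)) = - ntrace S (op_mult S (op_commutator S H X) A)"
proof -
  have diffr: "ntrace S (op_mult S X (\<lambda>s s'. P s s' - Q s s')) = ntrace S (op_mult S X P) - ntrace S (op_mult S X Q)"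
   and diffl: "ntrace S (op_mult S (\<lambda>s s'. P s s' - Q s s') X) = ntrace S (op_mult S P X) - ntrace S (op_mult S Q X)"
    for P Q X by (simp_all add: ntrace_def op_mult_def algebra_simps sum_subtractf diff_divide_distrib)
  have "ntrace S (op_mult S X (op_mult S A H)) = ntrace S (op_mult S (op_mult S H X) A)"
    using ntrace_mult_commute[of S "op_mult S X A" H] by (simp add: op_mult_assoc assms)
  then show ?thesis
    unfolding op_commutator_def diffr diffl by (simp add: op_mult_assoc assms)
qed

text \<open>The commutator has to stand inside the evolution: only then does a commutator that is
  linear in the Majorana operators yield a closed system. Differentiating the factor W evolved
  backwards, then moving the commutator across by the antisymmetry of the trace pairing, puts it
  there.\<close>

lemma ntrace_heis_deriv:
  assumes "finite S" "H \<in> alg S"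
  shows "((\<lambda>z. ntrace S (op_mult S W (heis S H z A))) has_field_derivative
     ntrace S (op_mult S W (heis S H z (op_commutator S H A)))) (at z)"
proof -
  have "((\<lambda>z. heis S H (- z) W s s') has_field_derivative - op_commutator S H (heis S H (- z) W) s s') (at z)" for s s'
    using DERIV_chain'[OF DERIV_minus[OF DERIV_ident] heis_deriv[OF assms, of W s s' "- z"]] by simp
  note d = op_mult_deriv[OF this DERIV_const]
  have "((\<lambda>z. ntrace S (op_mult S (heis S H (- z) W) A)) has_field_derivative
     (\<Sum>s\<in>confs S. op_mult S (\<lambda>s s'. - op_commutator S H (heis S H (- z) W) s s') A s s +
        op_mult S (heis S H (- z) W) (\<lambda>s s'. 0) s s) / of_nat (card (confs S))) (at z)"
    unfolding ntrace_def by (intro DERIV_cdivide DERIV_sum d)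
  also have "(\<Sum>s\<in>confs S. op_mult S (\<lambda>s s'. - op_commutator S H (heis S H (- z) W) s s') A s s +
        op_mult S (heis S H (- z) W) (\<lambda>s s'. 0) s s) / of_nat (card (confs S)) =
      - ntrace S (op_mult S (op_commutator S H (heis S H (- z) W)) A)"
    by (simp add: ntrace_def op_mult_def sum_negf)
  finally show ?thesis
    unfolding ntrace_heis[OF assms(1)] ntrace_commutator[OF assms(1)] .
qed

section \<open>Operator norms and Pauli strings\<close>

lemma L2_set_indicator: "finite S \<Longrightarrow> r \<in> S \<Longrightarrow> L2_set (\<lambda>s. cmod (if s = r then 1 else 0)) S = 1"
  by (simp add: L2_set_def if_distrib[of cmod] if_distrib[of "\<lambda>x. x ^ 2"] cong: if_cong)

lemma bdd_above_op_norm: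
  assumes "finite S"
  shows "bdd_above ((\<lambda>\<psi>. vec_norm S (op_apply S A \<psi>)) ` {\<psi>. vec_norm S \<psi> \<le> 1})"
proof (rule bdd_aboveI2)
  fix \<psi> assume "\<psi> \<in> {\<psi>. vec_norm S \<psi> \<le> 1}"
  then have "cmod (\<psi> r) \<le> 1" if "r \<in> confs S" for r
    using member_le_L2_set[OF finite_confs[OF assms] that, of "\<lambda>s. cmod (\<psi> s)"] by (simp add: vec_norm_def)
  then have "cmod (op_apply S A \<psi> s) \<le> (\<Sum>r\<in>confs S. cmod (A s r))" for s
    unfolding op_apply_def
    by (intro sum_norm_le) (auto simp: norm_mult intro: mult_left_le)
  then show "vec_norm S (op_apply S A \<psi>) \<le> (\<Sum>s\<in>confs S. \<Sum>r\<in>confs S. cmod (A s r))"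
    unfolding vec_norm_def by (intro order_trans[OF L2_set_le_sum] sum_mono) auto
qed

lemma op_norm_nonneg:
  assumes "finite S"
  shows "0 \<le> op_norm S A"
proof -
  have "vec_norm S (op_apply S A (\<lambda>_. 0)) \<le> op_norm S A"
    unfolding op_norm_def
    by (rule cSUP_upper[OF _ bdd_above_op_norm[OF assms]]) (simp add: vec_norm_def L2_set_def)
  then show ?thesis by (simp add: vec_norm_def op_apply_def L2_set_def)
qed

lemma column_norm_le_op_norm:
  assumes "finite S" "r \<in> confs S"
  shows "L2_set (\<lambda>s. cmod (A s r)) (confs S) \<le> op_norm S A"
proof -
  let ?e = "\<lambda>s. if s = r then 1 else 0 :: complex"
  have "vec_norm S (op_apply S A ?e) \<le> op_norm S A"
    unfolding op_norm_def
  proof (rule cSUP_upper[OF _ bdd_above_op_norm[OF assms(1)]])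
    show "?e \<in> {\<psi>. vec_norm S \<psi> \<le> 1}"
      unfolding vec_norm_def mem_Collect_eq
      by (subst L2_set_indicator[OF finite_confs[OF assms(1)] assms(2)]) simp
  qed
  moreover have "op_apply S A ?e s = A s r" for s
    using assms by (simp add: op_apply_def finite_confs if_distrib cong: if_cong)
  ultimately show ?thesis by (simp add: vec_norm_def)
qed

text \<open>Orthonormal columns make tensor products isometric; rows of length 1 serve the
  Cauchy-Schwarz estimate of traces.\<close>

definition unitary2 :: "complex^2^2 \<Rightarrow> bool" where
  "unitary2 a \<longleftrightarrow> (\<forall>x y. (\<Sum>k\<in>UNIV. cnj (a $ k $ x) * a $ k $ y) = (if x = y then 1 else 0)) \<and>
     (\<forall>x. (\<Sum>k\<in>UNIV. (cmod (a $ x $ k))\<^sup>2) = 1)"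

lemma tensor_row_norm:
  assumes "finite S" "\<And>i. i \<in> S \<Longrightarrow> unitary2 (a i)" "r \<in> confs S"
  shows "L2_set (\<lambda>s. cmod (tensor S a r s)) (confs S) = 1"
proof -
  have "(\<Sum>s\<in>confs S. (cmod (tensor S a r s))\<^sup>2) = (\<Sum>s\<in>confs S. \<Prod>j\<in>S. (cmod (a j $ r j $ s j))\<^sup>2)"
    using assms(3) by (intro sum.cong) (simp_all add: tensor_def prod_norm[symmetric] prod_power_distrib)
  also have "\<dots> = (\<Prod>j\<in>S. \<Sum>x\<in>UNIV. (cmod (a j $ r j $ x))\<^sup>2)"
    unfolding confs_def using assms(1) by (subst prod_sum_PiE) auto
  also have "\<dots> = 1"
    using assms(2) by (intro prod.neutral) (simp add: unitary2_def)
  finally show ?thesis by (simp add: L2_set_def)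
qed

lemma op_norm_tensor_le_1:
  assumes "finite S" "\<And>i. i \<in> S \<Longrightarrow> unitary2 (a i)"
  shows "op_norm S (tensor S a) \<le> 1"
  unfolding op_norm_def
proof (rule cSUP_least)
  show "{\<psi>. vec_norm S \<psi> \<le> 1} \<noteq> {}"
    by (auto simp: vec_norm_def L2_set_def intro!: exI[of _ "\<lambda>_. 0"])
  fix \<psi> assume \<psi>: "\<psi> \<in> {\<psi>. vec_norm S \<psi> \<le> 1}"
  let ?T = "tensor S a"
  have gram: "(\<Sum>s\<in>confs S. cnj (?T s r) * ?T s r') = (if r = r' then 1 else 0)"
    if "r \<in> confs S" "r' \<in> confs S" for r r'
  proof -
    have "(\<Sum>s\<in>confs S. cnj (?T s r) * ?T s r') =
        (\<Sum>s\<in>confs S. \<Prod>j\<in>S. cnj (a j $ s j $ r j) * a j $ s j $ r' j)"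
      using that by (intro sum.cong) (simp_all add: tensor_def prod.distrib)
    also have "\<dots> = (\<Prod>j\<in>S. \<Sum>x\<in>UNIV. cnj (a j $ x $ r j) * a j $ x $ r' j)"
      unfolding confs_def using assms(1) by (subst prod_sum_PiE) auto
    also have "\<dots> = (\<Prod>j\<in>S. mat 1 $ r j $ r' j)"
      using assms(2) by (intro prod.cong) (auto simp: unitary2_def mat_def)
    also have "\<dots> = op_one S r r'"
      using that by (simp add: op_one_def tensor_def)
    finally show ?thesis using that by (auto simp: op_one_eq[OF assms(1)])
  qed
  have "complex_of_real (\<Sum>s\<in>confs S. (cmod (op_apply S ?T \<psi> s))\<^sup>2) =
      (\<Sum>s\<in>confs S. cnj (op_apply S ?T \<psi> s) * op_apply S ?T \<psi> s)"
    by (simp only: of_real_sum complex_norm_square mult.commute)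
  also have "\<dots> = (\<Sum>s\<in>confs S. \<Sum>r\<in>confs S. \<Sum>r'\<in>confs S.
      (cnj (\<psi> r) * \<psi> r') * (cnj (?T s r) * ?T s r'))"
    unfolding op_apply_def cnj_sum complex_cnj_mult sum_product by (simp only: mult_ac)
  also have "\<dots> = (\<Sum>r\<in>confs S. \<Sum>s\<in>confs S. \<Sum>r'\<in>confs S.
      (cnj (\<psi> r) * \<psi> r') * (cnj (?T s r) * ?T s r'))"
    by (rule sum.swap)
  also have "\<dots> = (\<Sum>r\<in>confs S. \<Sum>r'\<in>confs S. \<Sum>s\<in>confs S.
      (cnj (\<psi> r) * \<psi> r') * (cnj (?T s r) * ?T s r'))"
    by (intro sum.cong refl sum.swap)
  also have "\<dots> = (\<Sum>r\<in>confs S. \<Sum>r'\<in>confs S. if r = r' then cnj (\<psi> r) * \<psi> r' else 0)"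
    by (intro sum.cong refl) (simp add: sum_distrib_left[symmetric] gram)
  also have "\<dots> = complex_of_real (\<Sum>s\<in>confs S. (cmod (\<psi> s))\<^sup>2)"
    unfolding of_real_sum complex_norm_square
    by (simp add: finite_confs assms(1) mult.commute)
  finally have "vec_norm S (op_apply S ?T \<psi>) = vec_norm S \<psi>"
    by (simp only: vec_norm_def L2_set_def of_real_eq_iff)
  with \<psi> show "vec_norm S (op_apply S ?T \<psi>) \<le> 1" by simp
qed

text \<open>Each diagonal contribution pairs a column of A, of length at most its operator norm,
  with a row of the tensor product, of length 1. Normalization cancels the dimension.\<close>

lemma ntrace_mult_tensor_le:
  assumes "finite S" "\<And>i. i \<in> S \<Longrightarrow> unitary2 (a i)"
  shows "cmod (ntrace S (op_mult S A (tensor S a))) \<le> op_norm S A"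
proof -
  let ?T = "tensor S a"
  have ne: "card (confs S) > 0"
    using finite_confs[OF assms(1)] by (auto simp: card_gt_0_iff confs_def PiE_eq_empty_iff)
  have "(\<Sum>s\<in>confs S. op_mult S A ?T s s) = (\<Sum>r\<in>confs S. \<Sum>s\<in>confs S. A s r * ?T r s)"
    unfolding op_mult_def by (rule sum.swap)
  also have "cmod \<dots> \<le> (\<Sum>r\<in>confs S. op_norm S A)"
  proof (rule sum_norm_le)
    fix r assume r: "r \<in> confs S"
    have "cmod (\<Sum>s\<in>confs S. A s r * ?T r s) \<le> (\<Sum>s\<in>confs S. \<bar>cmod (A s r)\<bar> * \<bar>cmod (?T r s)\<bar>)"
      by (rule order_trans[OF norm_sum]) (simp add: norm_mult)
    also have "\<dots> \<le> L2_set (\<lambda>s. cmod (A s r)) (confs S) * L2_set (\<lambda>s. cmod (?T r s)) (confs S)"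
      by (rule L2_set_mult_ineq)
    also have "\<dots> \<le> op_norm S A"
      using column_norm_le_op_norm[OF assms(1) r] by (simp add: tensor_row_norm assms r)
    finally show "cmod (\<Sum>s\<in>confs S. A s r * ?T r s) \<le> op_norm S A" .
  qed
  finally show ?thesis
    using ne by (simp add: ntrace_def norm_divide field_simps)
qed


section \<open>Pauli matrix algebra\<close>

text \<open>Stated entrywise, so that the scalars can be collected site by site in
  \<open>tensor_scale\<close>.\<close>

lemma sigma_products:
  fixes x y :: 2
  shows "(sigma_x ** sigma_x) $ x $ y = mat 1 $ x $ y"
    "(sigma_y ** sigma_y) $ x $ y = mat 1 $ x $ y"
    "(sigma_z ** sigma_z) $ x $ y = mat 1 $ x $ y"
    "(sigma_x ** sigma_y) $ x $ y = \<i> * sigma_z $ x $ y"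
    "(sigma_y ** sigma_x) $ x $ y = - \<i> * sigma_z $ x $ y"
    "(sigma_y ** sigma_z) $ x $ y = \<i> * sigma_x $ x $ y"
    "(sigma_z ** sigma_y) $ x $ y = - \<i> * sigma_x $ x $ y"
    "(sigma_z ** sigma_x) $ x $ y = \<i> * sigma_y $ x $ y"
    "(sigma_x ** sigma_z) $ x $ y = - \<i> * sigma_y $ x $ y"
  using exhaust_2[of x] exhaust_2[of y]
  by (auto simp: matrix_matrix_mult_def sum_2 sigma_x_def sigma_y_def sigma_z_def mat_def)

lemma unitary2_sigma: "unitary2 sigma_x" "unitary2 sigma_y" "unitary2 sigma_z" "unitary2 (mat 1)"
    "unitary2 (sigma_z ** sigma_x)" "unitary2 (sigma_z ** sigma_y)"
  by (auto simp: unitary2_def forall_2 sum_2 matrix_matrix_mult_def sigma_x_def sigma_y_def sigma_z_def mat_def)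

lemma tensor_scale:
  assumes "finite S" "\<And>i x y. i \<in> S \<Longrightarrow> a i $ x $ y = c i * b i $ x $ y"
  shows "tensor S a s s' = (\<Prod>i\<in>S. c i) * tensor S b s s'"
  using assms by (simp add: tensor_def prod.distrib)

section \<open>Jordan--Wigner transformation\<close>

text \<open>The Jordan-Wigner string ending at k: c = \<open>sigma_x\<close> gives the Majorana
  operator a_k, c = \<open>sigma_y\<close> gives b_k.\<close>

definition jw :: "complex^2^2 \<Rightarrow> int \<Rightarrow> int \<Rightarrow> complex^2^2" where
  "jw c k i = (if i < k then sigma_z else if i = k then c else mat 1)"

text \<open>The value \<open>0\<close> off the chain absorbs the neighbours missing at its two ends.\<close>

definition maj :: "complex^2^2 \<Rightarrow> int \<Rightarrow> int \<Rightarrow> int \<Rightarrow> opr" where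
  "maj c m n k = (if k \<in> {m..n} then tensor {m..n} (jw c k) else (\<lambda>_ _. 0))"

lemma prod_two_sites:
  fixes x y :: complex and j :: int
  assumes "finite S" "j \<in> S" "j + 1 \<in> S"
  shows "(\<Prod>i\<in>S. if i = j then x else if i = j + 1 then y else 1) = x * y"
proof -
  have "(\<Prod>i\<in>S. if i = j then x else if i = j + 1 then y else 1) =
      (\<Prod>i\<in>S. (if i = j then x else 1) * (if i = j + 1 then y else 1))"
    by (intro prod.cong) auto
  then show ?thesis using assms by (simp add: prod.distrib)
qed

text \<open>Products of Pauli strings agree sitewise up to scalars in both orders, so a commutator
  is one string t times the difference of two products of scalars. For commuting strings, t is the
  product itself.\<close>

lemma commutator_tensor:
  assumes "finite S"
    and "\<And>i x y. i \<in> S \<Longrightarrow> (a i ** b i) $ x $ y = c i * t i $ x $ y"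
    and "\<And>i x y. i \<in> S \<Longrightarrow> (b i ** a i) $ x $ y = d i * t i $ x $ y"
  shows "op_commutator S (tensor S a) (tensor S b) s s' = (prod c S - prod d S) * tensor S t s s'"
  using tensor_scale[of S "\<lambda>i. a i ** b i" c t, OF assms(1,2)]
    tensor_scale[of S "\<lambda>i. b i ** a i" d t, OF assms(1,3)]
  by (simp add: op_commutator_def tensor_mult[OF assms(1)] left_diff_distrib)

definition bond :: "complex^2^2 \<Rightarrow> int \<Rightarrow> int \<Rightarrow> complex^2^2" where
  "bond c j i = (if i = j \<or> i = j + 1 then c else mat 1)"

lemma commutator_bond:
  assumes "m \<le> j" "j < n"
    and "\<And>i x y. (bond e j i ** b i) $ x $ y = (if i = j then c1 else if i = j + 1 then c2 else 1) * t i $ x $ y"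
    and "\<And>i x y. (b i ** bond e j i) $ x $ y = (if i = j then d1 else if i = j + 1 then d2 else 1) * t i $ x $ y"
  shows "op_commutator {m..n} (tensor {m..n} (bond e j)) (tensor {m..n} b) s s' =
    (c1 * c2 - d1 * d2) * tensor {m..n} t s s'"
  using commutator_tensor[OF finite_atLeastAtMost_int assms(3,4), of m n] assms(1,2)
  by (simp add: prod_two_sites)

lemma bond_eq: "op_mult {m..n} (site_op {m..n} j c) (site_op {m..n} (j + 1) c) = tensor {m..n} (bond c j)"
  unfolding site_op_def tensor_mult[OF finite_atLeastAtMost_int]
  by (rule arg_cong[where f = "tensor {m..n}"]) (auto simp: bond_def)

text \<open>A bond meets the string at two sites, and the commutator survives only if exactly one of
  these pairs anticommutes. Inside the string both do, beyond it neither does; what is left is the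
  bond at which the string gets longer or shorter by one site. The other three bond commutators
  follow the same rule.\<close>

lemma commutator_bond_x_a:
  assumes "m \<le> j" "j < n" "m \<le> k" "k \<le> n"
  shows "op_commutator {m..n} (tensor {m..n} (bond sigma_x j)) (maj sigma_x m n k) s s' =
    (if j = k - 1 then - 2 * \<i> * maj sigma_y m n (k - 1) s s' else 0)"
proof (cases "j = k - 1")
  case True
  show ?thesis
    using commutator_bond[of m j n sigma_x "jw sigma_x k" "- \<i>" 1 "jw sigma_y j" "\<i>" 1 s s'] True assms
    by (auto simp: maj_def bond_def jw_def sigma_products)
next
  case False
  \<comment> \<open>The sign from each of the two sites; two anticommutations cancel.\<close>
  let ?e = "if j < k - 1 then - 1 else 1 :: complex"
  show ?thesis
    using commutator_bond[of m j n sigma_x "jw sigma_x k" 1 1 "\<lambda>i. bond sigma_x j i ** jw sigma_x k i" ?e ?e s s'] False assms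
    by (auto simp: maj_def bond_def jw_def sigma_products)
qed

lemma commutator_bond_x_b:
  assumes "m \<le> j" "j < n" "m \<le> k" "k \<le> n"
  shows "op_commutator {m..n} (tensor {m..n} (bond sigma_x j)) (maj sigma_y m n k) s s' =
    (if j = k then 2 * \<i> * maj sigma_x m n (k + 1) s s' else 0)"
proof (cases "j = k")
  case True
  show ?thesis
    using commutator_bond[of m j n sigma_x "jw sigma_y k" "\<i>" 1 "jw sigma_x (j + 1)" "- \<i>" 1 s s'] True assms
    by (auto simp: maj_def bond_def jw_def sigma_products)
next
  case False
  let ?e = "if j < k then - 1 else 1 :: complex"
  show ?thesis
    using commutator_bond[of m j n sigma_x "jw sigma_y k" 1 1 "\<lambda>i. bond sigma_x j i ** jw sigma_y k i" ?e ?e s s'] False assms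
    by (auto simp: maj_def bond_def jw_def sigma_products)
qed

lemma commutator_bond_y_a:
  assumes "m \<le> j" "j < n" "m \<le> k" "k \<le> n"
  shows "op_commutator {m..n} (tensor {m..n} (bond sigma_y j)) (maj sigma_x m n k) s s' =
    (if j = k then - 2 * \<i> * maj sigma_y m n (k + 1) s s' else 0)"
proof (cases "j = k")
  case True
  show ?thesis
    using commutator_bond[of m j n sigma_y "jw sigma_x k" "- \<i>" 1 "jw sigma_y (j + 1)" "\<i>" 1 s s'] True assms
    by (auto simp: maj_def bond_def jw_def sigma_products)
next
  case False
  let ?e = "if j < k then - 1 else 1 :: complex"
  show ?thesis
    using commutator_bond[of m j n sigma_y "jw sigma_x k" 1 1 "\<lambda>i. bond sigma_y j i ** jw sigma_x k i" ?e ?e s s'] False assms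
    by (auto simp: maj_def bond_def jw_def sigma_products)
qed

lemma commutator_bond_y_b:
  assumes "m \<le> j" "j < n" "m \<le> k" "k \<le> n"
  shows "op_commutator {m..n} (tensor {m..n} (bond sigma_y j)) (maj sigma_y m n k) s s' =
    (if j = k - 1 then 2 * \<i> * maj sigma_x m n (k - 1) s s' else 0)"
proof (cases "j = k - 1")
  case True
  show ?thesis
    using commutator_bond[of m j n sigma_y "jw sigma_y k" "\<i>" 1 "jw sigma_x j" "- \<i>" 1 s s'] True assms
    by (auto simp: maj_def bond_def jw_def sigma_products)
next
  case False
  let ?e = "if j < k - 1 then - 1 else 1 :: complex"
  show ?thesis
    using commutator_bond[of m j n sigma_y "jw sigma_y k" 1 1 "\<lambda>i. bond sigma_y j i ** jw sigma_y k i" ?e ?e s s'] False assms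
    by (auto simp: maj_def bond_def jw_def sigma_products)
qed

lemma commutator_z_a:
  assumes "m \<le> j" "j \<le> n" "m \<le> k" "k \<le> n"
  shows "op_commutator {m..n} (site_op {m..n} j sigma_z) (maj sigma_x m n k) s s' =
    (if j = k then 2 * \<i> * maj sigma_y m n k s s' else 0)"
proof (cases "j = k")
  case True
  show ?thesis
    using commutator_tensor[of "{m..n}" "\<lambda>i. if i = j then sigma_z else mat 1" "jw sigma_x k"
        "\<lambda>i. if i = j then \<i> else 1" "jw sigma_y k"
        "\<lambda>i. if i = j then - \<i> else 1" s s'] True assms
    by (auto simp: maj_def site_op_def jw_def sigma_products)
next
  case False
  show ?thesis
    using commutator_tensor[of "{m..n}" "\<lambda>i. if i = j then sigma_z else mat 1" "jw sigma_x k"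
        "\<lambda>i. 1" "\<lambda>i. (if i = j then sigma_z else mat 1) ** jw sigma_x k i" "\<lambda>i. 1" s s'] False assms
    by (auto simp: maj_def site_op_def jw_def sigma_products)
qed

lemma commutator_z_b:
  assumes "m \<le> j" "j \<le> n" "m \<le> k" "k \<le> n"
  shows "op_commutator {m..n} (site_op {m..n} j sigma_z) (maj sigma_y m n k) s s' =
    (if j = k then - 2 * \<i> * maj sigma_x m n k s s' else 0)"
proof (cases "j = k")
  case True
  show ?thesis
    using commutator_tensor[of "{m..n}" "\<lambda>i. if i = j then sigma_z else mat 1" "jw sigma_y k"
        "\<lambda>i. if i = j then - \<i> else 1" "jw sigma_x k"
        "\<lambda>i. if i = j then \<i> else 1" s s'] True assms
    by (auto simp: maj_def site_op_def jw_def sigma_products)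
next
  case False
  show ?thesis
    using commutator_tensor[of "{m..n}" "\<lambda>i. if i = j then sigma_z else mat 1" "jw sigma_y k"
        "\<lambda>i. 1" "\<lambda>i. (if i = j then sigma_z else mat 1) ** jw sigma_y k i" "\<lambda>i. 1" s s'] False assms
    by (auto simp: maj_def site_op_def jw_def sigma_products)
qed

lemma commutator_hamiltonian:
  "op_commutator {m..n} (xy_hamiltonian \<mu> \<gamma> \<nu> m n) A s s' =
     (\<Sum>j\<in>{m..<n}. of_real (\<mu> j) *
        (of_real (1 + \<gamma> j) * op_commutator {m..n} (tensor {m..n} (bond sigma_x j)) A s s' +
         of_real (1 - \<gamma> j) * op_commutator {m..n} (tensor {m..n} (bond sigma_y j)) A s s')) +
     (\<Sum>j\<in>{m..n}. of_real (\<nu> j) * op_commutator {m..n} (site_op {m..n} j sigma_z) A s s')"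
proof -
  have l: "op_mult S (\<lambda>s s'. P s s' + Q s s') A s s' = op_mult S P A s s' + op_mult S Q A s s'"
    "op_mult S A (\<lambda>s s'. P s s' + Q s s') s s' = op_mult S A P s s' + op_mult S A Q s s'"
    "op_mult S (\<lambda>s s'. c * P s s') A s s' = c * op_mult S P A s s'"
    "op_mult S A (\<lambda>s s'. c * P s s') s s' = c * op_mult S A P s s'"
    for S :: "int set" and P Q A and c :: complex and s s'
    by (simp_all add: op_mult_def algebra_simps sum.distrib sum_distrib_left)
  have sl: "op_mult S (\<lambda>s s'. \<Sum>j\<in>J. P j s s') A s s' = (\<Sum>j\<in>J. op_mult S (P j) A s s')"
    "op_mult S A (\<lambda>s s'. \<Sum>j\<in>J. P j s s') s s' = (\<Sum>j\<in>J. op_mult S A (P j) s s')"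
    for S J :: "int set" and P A s s'
    by (simp_all add: op_mult_def sum_distrib_left sum_distrib_right, (rule sum.swap)+)
  show ?thesis
    unfolding op_commutator_def xy_hamiltonian_def[abs_def] bond_eq l sl
    by (simp add: algebra_simps sum_subtractf sum.distrib)
qed

text \<open>The commutator stays within the span of the b operators. Together with its counterpart
  for b this makes the chain free, and it is the origin of the weights \<mu> (1 + \<gamma>) and
  \<mu> (1 - \<gamma>) called u and l.\<close>

lemma commutator_a:
  assumes "m \<le> k" "k \<le> n"
  shows "op_commutator {m..n} (xy_hamiltonian \<mu> \<gamma> \<nu> m n) (maj sigma_x m n k) s s' =
    - 2 * \<i> * (of_real (\<mu> (k - 1) * (1 + \<gamma> (k - 1))) * maj sigma_y m n (k - 1) s s' +
      of_real (\<mu> k * (1 - \<gamma> k)) * maj sigma_y m n (k + 1) s s' - of_real (\<nu> k) * maj sigma_y m n k s s')"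
proof -
  have "(\<Sum>j\<in>{m..<n}. of_real (\<mu> j) *
        (of_real (1 + \<gamma> j) * op_commutator {m..n} (tensor {m..n} (bond sigma_x j)) (maj sigma_x m n k) s s' +
         of_real (1 - \<gamma> j) * op_commutator {m..n} (tensor {m..n} (bond sigma_y j)) (maj sigma_x m n k) s s')) =
     (\<Sum>j\<in>{m..<n}. (if j = k - 1 then of_real (\<mu> (k - 1) * (1 + \<gamma> (k - 1))) * (- 2 * \<i> * maj sigma_y m n (k - 1) s s') else 0)
       + (if j = k then of_real (\<mu> k * (1 - \<gamma> k)) * (- 2 * \<i> * maj sigma_y m n (k + 1) s s') else 0))"
    using assms by (intro sum.cong) (auto simp: commutator_bond_x_a commutator_bond_y_a algebra_simps)
  \<comment> \<open>At an end of the chain a bond is missing from the sum, but then the matching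
    \<open>maj\<close> is 0.\<close>
  also have "\<dots> = of_real (\<mu> (k - 1) * (1 + \<gamma> (k - 1))) * (- 2 * \<i> * maj sigma_y m n (k - 1) s s') +
      of_real (\<mu> k * (1 - \<gamma> k)) * (- 2 * \<i> * maj sigma_y m n (k + 1) s s')"
    using assms by (auto simp: sum.distrib maj_def)
  moreover have "(\<Sum>j\<in>{m..n}. of_real (\<nu> j) * op_commutator {m..n} (site_op {m..n} j sigma_z) (maj sigma_x m n k) s s') =
     (\<Sum>j\<in>{m..n}. if j = k then of_real (\<nu> k) * (2 * \<i> * maj sigma_y m n k s s') else 0)"
    using assms by (intro sum.cong) (auto simp: commutator_z_a)
  ultimately show ?thesis
    unfolding commutator_hamiltonian using assms by (simp add: algebra_simps)
qed

lemma commutator_b: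
  assumes "m \<le> k" "k \<le> n"
  shows "op_commutator {m..n} (xy_hamiltonian \<mu> \<gamma> \<nu> m n) (maj sigma_y m n k) s s' =
    2 * \<i> * (of_real (\<mu> k * (1 + \<gamma> k)) * maj sigma_x m n (k + 1) s s' +
      of_real (\<mu> (k - 1) * (1 - \<gamma> (k - 1))) * maj sigma_x m n (k - 1) s s' - of_real (\<nu> k) * maj sigma_x m n k s s')"
proof -
  have "(\<Sum>j\<in>{m..<n}. of_real (\<mu> j) *
        (of_real (1 + \<gamma> j) * op_commutator {m..n} (tensor {m..n} (bond sigma_x j)) (maj sigma_y m n k) s s' +
         of_real (1 - \<gamma> j) * op_commutator {m..n} (tensor {m..n} (bond sigma_y j)) (maj sigma_y m n k) s s')) =
     (\<Sum>j\<in>{m..<n}. (if j = k - 1 then of_real (\<mu> (k - 1) * (1 - \<gamma> (k - 1))) * (2 * \<i> * maj sigma_x m n (k - 1) s s') else 0)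
       + (if j = k then of_real (\<mu> k * (1 + \<gamma> k)) * (2 * \<i> * maj sigma_x m n (k + 1) s s') else 0))"
    using assms by (intro sum.cong) (auto simp: commutator_bond_x_b commutator_bond_y_b algebra_simps)
  also have "\<dots> = of_real (\<mu> (k - 1) * (1 - \<gamma> (k - 1))) * (2 * \<i> * maj sigma_x m n (k - 1) s s') +
      of_real (\<mu> k * (1 + \<gamma> k)) * (2 * \<i> * maj sigma_x m n (k + 1) s s')"
    using assms by (auto simp: sum.distrib maj_def)
  moreover have "(\<Sum>j\<in>{m..n}. of_real (\<nu> j) * op_commutator {m..n} (site_op {m..n} j sigma_z) (maj sigma_y m n k) s s') =
     (\<Sum>j\<in>{m..n}. if j = k then of_real (\<nu> k) * (- 2 * \<i> * maj sigma_x m n k s s') else 0)"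
    using assms by (intro sum.cong) (auto simp: commutator_z_b)
  ultimately show ?thesis
    unfolding commutator_hamiltonian using assms by (simp add: algebra_simps)
qed

lemma tensor_cong: "(\<And>i. i \<in> S \<Longrightarrow> a i = b i) \<Longrightarrow> tensor S a = tensor S b"
  by (intro ext) (simp add: tensor_def)

lemma ntrace_tensor_eq_0:
  assumes "finite S" "j \<in> S" "(\<Sum>x\<in>UNIV. a j $ x $ x) = 0"
  shows "ntrace S (tensor S a) = 0"
proof -
  have "(\<Sum>s\<in>confs S. tensor S a s s) = (\<Sum>s\<in>confs S. \<Prod>i\<in>S. a i $ s i $ s i)"
    by (intro sum.cong) (simp_all add: tensor_def)
  also have "\<dots> = (\<Prod>i\<in>S. \<Sum>x\<in>UNIV. a i $ x $ x)"
    unfolding confs_def using assms(1) by (subst prod_sum_PiE) auto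
  also have "\<dots> = 0" using assms by (intro prod_zero) auto
  finally show ?thesis by (simp add: ntrace_def)
qed

lemma ntrace_one:
  assumes "finite S"
  shows "ntrace S (op_one S) = 1"
proof -
  have "card (confs S) > 0"
    using finite_confs[OF assms] by (auto simp: card_gt_0_iff confs_def PiE_eq_empty_iff)
  then show ?thesis by (simp add: ntrace_def op_one_eq[OF assms])
qed

lemma xy_hamiltonian_in_alg: "xy_hamiltonian \<mu> \<gamma> \<nu> m n \<in> alg {m..n}"
proof -
  have "site_op {m..n} j c \<in> alg {m..n}" for j c by (simp add: site_op_def tensor_in_alg)
  then show ?thesis
    using tensor_in_alg[of "{m..n}"] unfolding xy_hamiltonian_def[abs_def] bond_eq alg_def by auto
qed

section \<open>The one-particle propagator\<close>

text \<open>The coefficient of a_j in the evolved a_k or b_k, read off by the trace, for which the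
  Majorana operators are orthonormal.\<close>

definition corr ::
    "(int \<Rightarrow> real) \<Rightarrow> (int \<Rightarrow> real) \<Rightarrow> (int \<Rightarrow> real) \<Rightarrow> int \<Rightarrow> int \<Rightarrow> int \<Rightarrow> complex^2^2 \<Rightarrow> int \<Rightarrow> complex \<Rightarrow> complex" where
  "corr \<mu> \<gamma> \<nu> m n j c k z = ntrace {m..n} (op_mult {m..n} (maj sigma_x m n j)
     (heis {m..n} (xy_hamiltonian \<mu> \<gamma> \<nu> m n) z (maj c m n k)))"

lemma corr_outside: "k \<notin> {m..n} \<Longrightarrow> corr \<mu> \<gamma> \<nu> m n j c k z = 0"
  by (simp only: corr_def maj_def if_False) (simp add: heis_def op_mult_def ntrace_def)

lemma ntrace_heis_linear:
  assumes "finite S"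
  shows "ntrace S (op_mult S W (heis S H z (\<lambda>s s'. c * (x * A s s' + y * B s s' - w * D s s')))) =
    c * (x * ntrace S (op_mult S W (heis S H z A)) + y * ntrace S (op_mult S W (heis S H z B))
      - w * ntrace S (op_mult S W (heis S H z D)))"
  unfolding ntrace_heis[OF assms]
  by (simp add: ntrace_def op_mult_def algebra_simps sum.distrib sum_subtractf sum_distrib_left
      add_divide_distrib diff_divide_distrib)

lemma corr_deriv_a:
  assumes "m \<le> k" "k \<le> n"
  shows "(corr \<mu> \<gamma> \<nu> m n j sigma_x k has_field_derivative
    - 2 * \<i> * (of_real (\<mu> (k - 1) * (1 + \<gamma> (k - 1))) * corr \<mu> \<gamma> \<nu> m n j sigma_y (k - 1) z +
      of_real (\<mu> k * (1 - \<gamma> k)) * corr \<mu> \<gamma> \<nu> m n j sigma_y (k + 1) z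
      - of_real (\<nu> k) * corr \<mu> \<gamma> \<nu> m n j sigma_y k z)) (at z)"
proof -
  have c: "op_commutator {m..n} (xy_hamiltonian \<mu> \<gamma> \<nu> m n) (maj sigma_x m n k) =
    (\<lambda>s s'. - 2 * \<i> * (of_real (\<mu> (k - 1) * (1 + \<gamma> (k - 1))) * maj sigma_y m n (k - 1) s s' +
      of_real (\<mu> k * (1 - \<gamma> k)) * maj sigma_y m n (k + 1) s s' - of_real (\<nu> k) * maj sigma_y m n k s s'))"
    by (intro ext commutator_a assms)
  show ?thesis
    using ntrace_heis_deriv[OF finite_atLeastAtMost_int xy_hamiltonian_in_alg,
        of m n "maj sigma_x m n j" \<mu> \<gamma> \<nu> "maj sigma_x m n k" z]
    unfolding c ntrace_heis_linear[OF finite_atLeastAtMost_int] corr_def[symmetric] by simp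
qed

lemma corr_deriv_b:
  assumes "m \<le> k" "k \<le> n"
  shows "(corr \<mu> \<gamma> \<nu> m n j sigma_y k has_field_derivative
    2 * \<i> * (of_real (\<mu> k * (1 + \<gamma> k)) * corr \<mu> \<gamma> \<nu> m n j sigma_x (k + 1) z +
      of_real (\<mu> (k - 1) * (1 - \<gamma> (k - 1))) * corr \<mu> \<gamma> \<nu> m n j sigma_x (k - 1) z
      - of_real (\<nu> k) * corr \<mu> \<gamma> \<nu> m n j sigma_x k z)) (at z)"
proof -
  have c: "op_commutator {m..n} (xy_hamiltonian \<mu> \<gamma> \<nu> m n) (maj sigma_y m n k) =
    (\<lambda>s s'. 2 * \<i> * (of_real (\<mu> k * (1 + \<gamma> k)) * maj sigma_x m n (k + 1) s s' +
      of_real (\<mu> (k - 1) * (1 - \<gamma> (k - 1))) * maj sigma_x m n (k - 1) s s' - of_real (\<nu> k) * maj sigma_x m n k s s'))"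
    by (intro ext commutator_b assms)
  show ?thesis
    using ntrace_heis_deriv[OF finite_atLeastAtMost_int xy_hamiltonian_in_alg,
        of m n "maj sigma_x m n j" \<mu> \<gamma> \<nu> "maj sigma_y m n k" z]
    unfolding c ntrace_heis_linear[OF finite_atLeastAtMost_int] corr_def[symmetric] by simp
qed

lemma maj_in_alg: "maj c m n k \<in> alg {m..n}"
  by (cases "k \<in> {m..n}") (simp_all only: maj_def tensor_in_alg if_True if_False, simp add: alg_def)

lemma corr_0:
  assumes "j \<in> {m..n}" "k \<in> {m..n}"
  shows "corr \<mu> \<gamma> \<nu> m n j sigma_x k 0 = (if k = j then 1 else 0)"
    and "corr \<mu> \<gamma> \<nu> m n j sigma_y k 0 = 0"
proof -
  have eq: "corr \<mu> \<gamma> \<nu> m n j c k 0 = ntrace {m..n} (tensor {m..n} (\<lambda>i. jw sigma_x j i ** jw c k i))" for c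
    using assms by (simp add: corr_def heis_0 maj_in_alg) (simp add: maj_def tensor_mult)
  have tr: "(\<Sum>x\<in>UNIV. (sigma_x ** sigma_z) $ x $ x) = 0" "(\<Sum>x\<in>UNIV. (sigma_z ** sigma_x) $ x $ x) = 0"
     "(\<Sum>x\<in>UNIV. (sigma_z ** sigma_y) $ x $ x) = 0" "(\<Sum>x\<in>UNIV. (sigma_x ** sigma_y) $ x $ x) = 0"
    unfolding sigma_products by (simp_all add: sum_2 sigma_x_def sigma_y_def sigma_z_def)
  \<comment> \<open>The shorter string ends at site min j k, and there the product of the two
    strings is traceless; for j = k it is i times \<open>sigma_z\<close>.\<close>
  show "corr \<mu> \<gamma> \<nu> m n j sigma_y k 0 = 0"
    unfolding eq by (rule ntrace_tensor_eq_0[of _ "min j k"]) (use assms tr in \<open>auto simp: jw_def min_def\<close>)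
  show "corr \<mu> \<gamma> \<nu> m n j sigma_x k 0 = (if k = j then 1 else 0)"
  proof (cases "k = j")
    case True
    have "(\<lambda>i. jw sigma_x j i ** jw sigma_x k i) = (\<lambda>i. mat 1)"
      unfolding True by (intro ext) (auto simp: jw_def vec_eq_iff sigma_products)
    then show ?thesis unfolding eq using True by (simp add: op_one_def[symmetric] ntrace_one)
  next
    case False
    have "corr \<mu> \<gamma> \<nu> m n j sigma_x k 0 = 0"
      unfolding eq by (rule ntrace_tensor_eq_0[of _ "min j k"]) (use assms tr False in \<open>auto simp: jw_def min_def\<close>)
    then show ?thesis using False by simp
  qed
qed

text \<open>\<open>maj c m n j\<close> anticommutes with $\sigma^{(z)}_j$, so its coefficient in \<open>X\<close> is read off
  from the commutator of \<open>X\<close> with $\sigma^{(z)}_j$.\<close>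

lemma ntrace_maj_le_commutator:
  assumes "j \<in> {m..n}" "c = sigma_x \<or> c = sigma_y"
  shows "2 * cmod (ntrace {m..n} (op_mult {m..n} X (maj c m n j))) \<le>
    op_norm {m..n} (op_commutator {m..n} X (site_op {m..n} j sigma_z))"
proof -
  let ?S = "{m..n}" and ?z = "\<lambda>i. if i = j then sigma_z else mat 1"
  let ?Z = "site_op ?S j sigma_z" and ?W = "tensor ?S (jw c j)"
  \<comment> \<open>The test string Y = Z W has Z Y = W and Y Z = - W, so the trace of [X, Z] Y is
    twice that of X W.\<close>
  let ?Y = "tensor ?S (\<lambda>i. ?z i ** jw c j i)"
  have zz: "sigma_z ** sigma_z = mat 1" by (simp add: vec_eq_iff sigma_products)
  have ZY: "op_mult ?S ?Z ?Y = ?W"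
    unfolding site_op_def tensor_mult[OF finite_atLeastAtMost_int]
    by (rule tensor_cong) (auto simp: matrix_mul_assoc zz)
  have anti: "((sigma_z ** c) ** sigma_z) $ x $ y = - c $ x $ y" for x y :: 2
    using assms(2) exhaust_2[of x] exhaust_2[of y]
    by (auto simp: matrix_matrix_mult_def sum_2 sigma_x_def sigma_y_def sigma_z_def)
  have YZ: "op_mult ?S ?Y ?Z s s' = - ?W s s'" for s s'
    using tensor_scale[of ?S "\<lambda>i. (?z i ** jw c j i) ** ?z i" "\<lambda>i. if i = j then - 1 else 1" "jw c j" s s'] assms(1)
    by (auto simp: site_op_def tensor_mult anti jw_def)
  have "ntrace ?S (op_mult ?S (op_commutator ?S X ?Z) ?Y) =
      ntrace ?S (op_mult ?S (op_mult ?S X ?Z) ?Y) - ntrace ?S (op_mult ?S (op_mult ?S ?Z X) ?Y)"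
    by (simp add: ntrace_def op_commutator_def op_mult_def[of _ "\<lambda>s s'. P s s'" ?Y for P] algebra_simps
        sum_subtractf diff_divide_distrib)
  also have "ntrace ?S (op_mult ?S (op_mult ?S X ?Z) ?Y) = ntrace ?S (op_mult ?S X ?W)"
    by (simp add: op_mult_assoc ZY)
  also have "ntrace ?S (op_mult ?S (op_mult ?S ?Z X) ?Y) = ntrace ?S (op_mult ?S ?Z (op_mult ?S X ?Y))"
    by (simp add: op_mult_assoc)
  also have "\<dots> = ntrace ?S (op_mult ?S X (op_mult ?S ?Y ?Z))"
    by (subst ntrace_mult_commute) (simp add: op_mult_assoc)
  also have "\<dots> = - ntrace ?S (op_mult ?S X ?W)"
    by (simp add: ntrace_def op_mult_def[of _ X] YZ sum_negf)
  finally have "2 * ntrace ?S (op_mult ?S X ?W) = ntrace ?S (op_mult ?S (op_commutator ?S X ?Z) ?Y)"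
    by simp
  then have "2 * cmod (ntrace ?S (op_mult ?S X ?W)) = cmod (ntrace ?S (op_mult ?S (op_commutator ?S X ?Z) ?Y))"
    by (metis norm_mult norm_numeral)
  also have "\<dots> \<le> op_norm ?S (op_commutator ?S X ?Z)"
    by (rule ntrace_mult_tensor_le) (use assms(2) in \<open>auto simp: jw_def unitary2_sigma\<close>)
  finally show ?thesis using assms(1) by (simp add: maj_def)
qed

section \<open>From the Lieb-Robinson bound to decay of the propagator\<close>

lemma lieb_robinsonD:
  assumes "lieb_robinson \<mu> \<gamma> \<nu> C \<eta> v"
    and "S \<subseteq> {m..n}" "T \<subseteq> {m..n}" "S \<noteq> {}" "T \<noteq> {}" "S \<inter> T = {}" "A \<in> alg S" "B \<in> alg T"
  shows "op_norm {m..n} (op_commutator {m..n}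
      (xy_evolution \<mu> \<gamma> \<nu> m n t (op_embed S {m..n} A)) (op_embed T {m..n} B))
    \<le> C (card (interaction_boundary S)) (card (interaction_boundary T)) *
       op_norm S A * op_norm T B * exp (- \<eta> * (of_int (set_distance S T) - v * \<bar>t\<bar>))"
  using assms unfolding lieb_robinson_def by blast

text \<open>The string lives on {m..k}, whose boundary {m, k} has one or two points however long it
  is, so only C 1 1 and C 2 1 can occur. The single site j lies beyond the string at distance j -
  k.\<close>

lemma lieb_robinson_maj:
  assumes LR: "lieb_robinson \<mu> \<gamma> \<nu> C \<eta> v" and "m \<le> k" "k < j" "j \<le> n" and c: "c = sigma_x \<or> c = sigma_y"
  shows "op_norm {m..n} (op_commutator {m..n}
      (heis {m..n} (xy_hamiltonian \<mu> \<gamma> \<nu> m n) (\<i> * of_real t) (maj c m n k)) (site_op {m..n} j sigma_z))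
    \<le> max (C 1 1) (C 2 1) * exp (- \<eta> * (of_int (j - k) - v * \<bar>t\<bar>))"
proof -
  let ?A = "tensor {m..k} (jw c k)" and ?B = "tensor {j} (\<lambda>_. sigma_z)"
  have A: "op_embed {m..k} {m..n} ?A = maj c m n k"
    using assms(2-4) by (subst op_embed_tensor) (auto simp: maj_def jw_def intro!: tensor_cong)
  have B: "op_embed {j} {m..n} ?B = site_op {m..n} j sigma_z"
    using assms(2-4) by (subst op_embed_tensor) (auto simp: site_op_def intro!: tensor_cong)
  have bB: "interaction_boundary {j} = {j}"
    by (auto simp: interaction_boundary_def)
  have "interaction_boundary {m..k} = {m, k}"
    using assms(2) by (auto simp: interaction_boundary_def)
  then have bA: "card (interaction_boundary {m..k}) = (if m = k then 1 else 2)" by simp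
  have d: "j - k \<le> set_distance {m..k} {j}"
    unfolding set_distance_def using assms(2-4) by (subst Min_ge_iff) auto
  have sub: "{m..k} \<subseteq> {m..n}" "{j} \<subseteq> {m..n}" and ne: "{m..k} \<noteq> {}" "{j} \<noteq> {}"
    and disj: "{m..k} \<inter> {j} = {}"
    using assms(2-4) by auto
  have pos: "C a b > 0" "\<eta> > 0" for a b using LR by (auto simp: lieb_robinson_def)
  have "op_norm {m..n} (op_commutator {m..n}
      (heis {m..n} (xy_hamiltonian \<mu> \<gamma> \<nu> m n) (\<i> * of_real t) (maj c m n k)) (site_op {m..n} j sigma_z))
    \<le> C (if m = k then 1 else 2) 1 * op_norm {m..k} ?A * op_norm {j} ?B *
      exp (- \<eta> * (of_int (set_distance {m..k} {j}) - v * \<bar>t\<bar>))"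
    using lieb_robinsonD[OF LR sub ne disj tensor_in_alg[of _ "jw c k"] tensor_in_alg[of _ "\<lambda>_. sigma_z"], of t]
    unfolding A B xy_evolution_eq_heis bA bB by simp
  also have "\<dots> \<le> (max (C 1 1) (C 2 1) * 1 * 1) * exp (- \<eta> * (of_int (j - k) - v * \<bar>t\<bar>))"
  proof (intro mult_mono)
    show "op_norm {m..k} ?A \<le> 1" "op_norm {j} ?B \<le> 1"
      using c by (auto intro!: op_norm_tensor_le_1 simp: jw_def unitary2_sigma)
    have "real_of_int (j - k) \<le> real_of_int (set_distance {m..k} {j})" using d by linarith
    then show "exp (- \<eta> * (of_int (set_distance {m..k} {j}) - v * \<bar>t\<bar>)) \<le> exp (- \<eta> * (of_int (j - k) - v * \<bar>t\<bar>))"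
      using pos(2) by simp
  qed (auto simp: op_norm_nonneg less_imp_le[OF pos(1)] max_def)
  finally show ?thesis by simp
qed

text \<open>The test site has to lie beyond the evolved string. For k < j this is so at once. For k
  > j the string of k covers j, so the trace is rewritten with the string of j evolving backwards
  and tested at k.\<close>

lemma corr_decay:
  assumes LR: "lieb_robinson \<mu> \<gamma> \<nu> C \<eta> v" and "j \<in> {m..n}" "k \<in> {m..n}" "j \<noteq> k"
    and c: "c = sigma_x \<or> c = sigma_y"
  shows "cmod (corr \<mu> \<gamma> \<nu> m n j c k (\<i> * of_real t)) \<le>
    max (C 1 1) (C 2 1) * exp (- \<eta> * (of_int \<bar>k - j\<bar> - v * \<bar>t\<bar>))"
proof (cases "k < j")
  case True
  have "2 * cmod (corr \<mu> \<gamma> \<nu> m n j c k (\<i> * of_real t)) \<le> max (C 1 1) (C 2 1) * exp (- \<eta> * (of_int (j - k) - v * \<bar>t\<bar>))"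
    unfolding corr_def
    by (subst ntrace_mult_commute, rule order_trans[OF ntrace_maj_le_commutator])
      (use assms True lieb_robinson_maj[OF LR, of m k j n c t] in auto)
  moreover have e: "\<bar>k - j\<bar> = j - k" using True by simp
  ultimately show ?thesis
    unfolding e using norm_ge_zero[of "corr \<mu> \<gamma> \<nu> m n j c k (\<i> * of_real t)"] by linarith
next
  case False
  have "2 * cmod (corr \<mu> \<gamma> \<nu> m n j c k (\<i> * of_real t)) \<le> max (C 1 1) (C 2 1) * exp (- \<eta> * (of_int (k - j) - v * \<bar>t\<bar>))"
    unfolding corr_def
    by (subst ntrace_heis, simp, rule order_trans[OF ntrace_maj_le_commutator])
      (use assms False lieb_robinson_maj[OF LR, of m j k n sigma_x "- t"] in auto)
  moreover have e: "\<bar>k - j\<bar> = k - j" using False by simp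
  ultimately show ?thesis
    unfolding e using norm_ge_zero[of "corr \<mu> \<gamma> \<nu> m n j c k (\<i> * of_real t)"] by linarith
qed

section \<open>The lower bound on the velocity\<close>

lemma chain_ode_corr:
  "chain_ode (\<lambda>k. \<mu> k * (1 + \<gamma> k)) (\<lambda>k. \<mu> k * (1 - \<gamma> k)) \<nu> m n
     (\<lambda>k t. corr \<mu> \<gamma> \<nu> m n j sigma_x k (\<i> * of_real t)) (\<lambda>k t. corr \<mu> \<gamma> \<nu> m n j sigma_y k (\<i> * of_real t))"
proof -
  \<comment> \<open>The factor i from z = i t turns the coefficients - 2 i and 2 i into 2 and -
    2.\<close>
  have chain: "((\<lambda>t. F (\<i> * of_real t)) has_vector_derivative F' * \<i>) (at t)"
    if "(F has_field_derivative F') (at (\<i> * of_real t))" for F F' t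
  proof -
    have "((\<lambda>z. F (\<i> * z)) has_field_derivative F' * \<i>) (at (of_real t))"
      by (rule DERIV_chain'[where g = F]) (auto intro!: derivative_eq_intros that)
    from has_vector_derivative_real_field[OF this] show ?thesis .
  qed
  show ?thesis
    unfolding chain_ode_def
  proof (intro conjI allI impI ballI)
    fix k t assume k: "k \<in> {m..n}"
    show "((\<lambda>t. corr \<mu> \<gamma> \<nu> m n j sigma_x k (\<i> * of_real t)) has_vector_derivative
      2 *\<^sub>R ((\<mu> (k - 1) * (1 + \<gamma> (k - 1))) *\<^sub>R corr \<mu> \<gamma> \<nu> m n j sigma_y (k - 1) (\<i> * of_real t) +
        (\<mu> k * (1 - \<gamma> k)) *\<^sub>R corr \<mu> \<gamma> \<nu> m n j sigma_y (k + 1) (\<i> * of_real t) -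
        \<nu> k *\<^sub>R corr \<mu> \<gamma> \<nu> m n j sigma_y k (\<i> * of_real t))) (at t)"
      using k by (intro has_vector_derivative_eq_rhs[OF chain[OF corr_deriv_a]])
        (auto simp: scaleR_conv_of_real algebra_simps)
    show "((\<lambda>t. corr \<mu> \<gamma> \<nu> m n j sigma_y k (\<i> * of_real t)) has_vector_derivative
      (- 2) *\<^sub>R ((\<mu> k * (1 + \<gamma> k)) *\<^sub>R corr \<mu> \<gamma> \<nu> m n j sigma_x (k + 1) (\<i> * of_real t) +
        (\<mu> (k - 1) * (1 - \<gamma> (k - 1))) *\<^sub>R corr \<mu> \<gamma> \<nu> m n j sigma_x (k - 1) (\<i> * of_real t) -
        \<nu> k *\<^sub>R corr \<mu> \<gamma> \<nu> m n j sigma_x k (\<i> * of_real t))) (at t)"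
      using k by (intro has_vector_derivative_eq_rhs[OF chain[OF corr_deriv_b]])
        (auto simp: scaleR_conv_of_real algebra_simps)
  qed (simp_all add: corr_outside)
qed

text \<open>Unitarity allows one to lower the rate \<open>\<eta>\<close> of the Lieb--Robinson bound to any smaller rate
  while keeping the velocity, because $\min(1, e^{-\eta x}) \le e^{-\eta' x}$ for $0\le\eta'\le\eta$.\<close>

lemma corr_le_slower_rate:
  assumes LR: "lieb_robinson \<mu> \<gamma> \<nu> C \<eta> v" and "j \<in> {m..n}" "k \<in> {m..n}" and \<eta>': "0 \<le> \<eta>'" "\<eta>' \<le> \<eta>"
    and c: "c = sigma_x \<or> c = sigma_y" and t: "t \<ge> 0"
  shows "cmod (corr \<mu> \<gamma> \<nu> m n j c k (\<i> * of_real t)) \<le>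
    max 1 (max (C 1 1) (C 2 1)) * exp (\<eta>' * of_int \<bar>j\<bar>) * exp (- \<eta>' * (of_int \<bar>k\<bar> - v * t))"
proof -
  define x where "x = of_int \<bar>k - j\<bar> - v * t"
  let ?c = "cmod (corr \<mu> \<gamma> \<nu> m n j c k (\<i> * of_real t))"
  let ?M = "max 1 (max (C 1 1) (C 2 1))"
  have v: "v > 0" using LR by (simp add: lieb_robinson_def)
  have le_1: "?c \<le> 1"
    using c chain_ode_le_1[OF chain_ode_corr, of j m n k \<mu> \<gamma> \<nu> j t] corr_0[of j m n _ \<mu> \<gamma> \<nu>] assms(2,3) by auto
  have "?c \<le> ?M * exp (- \<eta>' * x)"
  proof (cases "x \<le> 0")
    case True
    have "1 \<le> exp (- \<eta>' * x)" using True \<eta>' by (simp add: mult_nonneg_nonpos)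
    then have "1 * 1 \<le> ?M * exp (- \<eta>' * x)" by (intro mult_mono) auto
    with le_1 show ?thesis by simp
  next
    case False
    \<comment> \<open>For k = j the value of x would be - v t \<le> 0. Hence the decay estimate,
      which is for distinct sites, applies.\<close>
    then have "k \<noteq> j" using v t unfolding x_def by (metis abs_zero diff_0 diff_self mult_nonneg_nonneg less_imp_le neg_le_0_iff_le of_int_0)
    then have "?c \<le> max (C 1 1) (C 2 1) * exp (- \<eta> * x)"
      using corr_decay[OF LR assms(2,3) _ c, of t] t by (simp add: x_def)
    also have "\<dots> \<le> ?M * exp (- \<eta>' * x)"
      using False \<eta>' by (intro mult_mono) (auto simp: mult_right_mono)
    finally show ?thesis .
  qed
  \<comment> \<open>Moving the centre from j to 0 costs the factor exp (\<eta>' |j|), harmless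
    because j stays fixed as N and t grow.\<close>
  also have "exp (- \<eta>' * x) \<le> exp (\<eta>' * of_int \<bar>j\<bar>) * exp (- \<eta>' * (of_int \<bar>k\<bar> - v * t))"
  proof -
    have "of_int \<bar>k\<bar> - of_int \<bar>j\<bar> \<le> (of_int \<bar>k - j\<bar> :: real)" by linarith
    then have "\<eta>' * (of_int \<bar>k\<bar> - of_int \<bar>j\<bar>) \<le> \<eta>' * of_int \<bar>k - j\<bar>" using \<eta>' by (intro mult_left_mono) auto
    then show ?thesis unfolding exp_add[symmetric] x_def by (simp add: algebra_simps)
  qed
  then have "?M * exp (- \<eta>' * x) \<le> ?M * (exp (\<eta>' * of_int \<bar>j\<bar>) * exp (- \<eta>' * (of_int \<bar>k\<bar> - v * t)))"
    by (intro mult_left_mono) auto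
  finally show ?thesis by (simp add: mult.assoc)
qed

text \<open>The prefactor is absent from the conclusion because exponential growth in t does not see
  it, and \<eta> only limits \<kappa>. The site j lies in one period, so all chains {-N..N} with N
  \<ge> p contain it.\<close>

lemma lieb_robinson_Re_le:
  fixes \<mu> \<gamma> \<nu> :: "int \<Rightarrow> real" and p :: nat and \<kappa> v \<eta> :: real
  assumes u_def: "u = (\<lambda>k. \<mu> k * (1 + \<gamma> k))" and l_def: "l = (\<lambda>k. \<mu> k * (1 - \<gamma> k))"
    and LR: "lieb_robinson \<mu> \<gamma> \<nu> C \<eta> v" and p: "p > 0"
    and per: "\<And>k. u (k + int p) = u k" "\<And>k. l (k + int p) = l k" "\<And>k. \<nu> (k + int p) = \<nu> k"
    and B: "\<And>k. \<bar>u k\<bar> \<le> B" "\<And>k. \<bar>l k\<bar> \<le> B"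
    and \<kappa>: "0 < \<kappa>" "2 * \<kappa> \<le> \<eta>" and y: "cmod y = exp \<kappa>"
    and \<rho>: "eigenvalue (bloch_mat p u l \<nu> y) \<rho>" and \<zeta>: "\<zeta>\<^sup>2 = - 4 * \<rho>" "\<zeta> \<noteq> 0"
  shows "Re \<zeta> \<le> 2 * \<kappa> * v"
proof -
  have v: "v > 0" using LR by (simp add: lieb_robinson_def)
  have B0: "B \<ge> 0" using B(1)[of 0] by linarith
  obtain \<alpha> \<beta> A j where wave: "bloch_wave u l \<nu> \<zeta> \<alpha> \<beta>" "\<alpha> j \<noteq> 0"
    "\<And>k. cmod (\<alpha> k) \<le> A * exp (\<kappa> * of_int \<bar>k\<bar>)" "\<And>k. cmod (\<beta> k) \<le> A * exp (\<kappa> * of_int \<bar>k\<bar>)"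
    and j: "0 \<le> j" "j < int p"
    using bloch_mat_eigenvalue_wave[OF p per \<rho> y \<kappa>(1) \<zeta>] by metis
  have jN: "j \<in> {- int N..int N}" if "N \<ge> p" for N using that j by auto
  have \<kappa>2: "0 \<le> 2 * \<kappa>" using \<kappa> by simp
  show ?thesis
  proof (rule bloch_growth_le[of p u l \<nu>])
    fix N assume "N \<ge> p"
    show "chain_ode u l \<nu> (- int N) (int N)
      (\<lambda>k t. corr \<mu> \<gamma> \<nu> (- int N) (int N) j sigma_x k (\<i> * of_real t))
      (\<lambda>k t. corr \<mu> \<gamma> \<nu> (- int N) (int N) j sigma_y k (\<i> * of_real t))"
      unfolding u_def l_def by (rule chain_ode_corr)
  next
    fix N k assume N: "N \<ge> p" "k \<in> {- int N..int N}"
    show "corr \<mu> \<gamma> \<nu> (- int N) (int N) j sigma_x k (\<i> * of_real 0) = (if k = j then 1 else 0) \<and>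
      corr \<mu> \<gamma> \<nu> (- int N) (int N) j sigma_y k (\<i> * of_real 0) = 0"
      using corr_0[OF jN[OF N(1)] N(2)] by simp
  next
    fix N k and t :: real assume N: "N \<ge> p" "k \<in> {- int N..int N}" and t: "t \<ge> 0"
    show "cmod (corr \<mu> \<gamma> \<nu> (- int N) (int N) j sigma_x k (\<i> * of_real t)) \<le>
        max 1 (max (C 1 1) (C 2 1)) * exp (2 * \<kappa> * of_int \<bar>j\<bar>) * exp (- (2 * \<kappa>) * (of_int \<bar>k\<bar> - v * t)) \<and>
      cmod (corr \<mu> \<gamma> \<nu> (- int N) (int N) j sigma_y k (\<i> * of_real t)) \<le>
        max 1 (max (C 1 1) (C 2 1)) * exp (2 * \<kappa> * of_int \<bar>j\<bar>) * exp (- (2 * \<kappa>) * (of_int \<bar>k\<bar> - v * t))"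
      by (intro conjI corr_le_slower_rate[OF LR jN[OF N(1)] N(2) \<kappa>2 \<kappa>(2) _ t]) auto
  qed (use wave B B0 j \<kappa> v in auto)
qed

text \<open>Both square roots \<zeta> and - \<zeta> of - 4 \<rho> belong to waves, so the one-sided
  bound becomes |Re \<zeta>| \<le> 2 \<kappa> v. As 4 |Im \<rho>| = 2 |Re \<zeta>| |Im \<zeta>| and
  |Im \<zeta>| is bounded, every eigenvalue is nearly real.\<close>

lemma lieb_robinson_Im_det_le:
  fixes \<mu> \<gamma> \<nu> :: "int \<Rightarrow> real" and p :: nat and \<kappa> v \<eta> B R :: real
  assumes u_def: "u = (\<lambda>k. \<mu> k * (1 + \<gamma> k))" and l_def: "l = (\<lambda>k. \<mu> k * (1 - \<gamma> k))"
    and LR: "lieb_robinson \<mu> \<gamma> \<nu> C \<eta> v" and p: "p > 0"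
    and per: "\<And>k. u (k + int p) = u k" "\<And>k. l (k + int p) = l k" "\<And>k. \<nu> (k + int p) = \<nu> k"
    and B: "\<And>k. \<bar>u k\<bar> \<le> B" "\<And>k. \<bar>l k\<bar> \<le> B" "\<And>k. \<bar>\<nu> k\<bar> \<le> B"
    and \<kappa>: "0 < \<kappa>" "2 * \<kappa> \<le> \<eta>" "\<kappa> \<le> 1" and y: "cmod y = exp \<kappa>"
    and R: "(3 * B * exp 1)\<^sup>2 \<le> R" "1 \<le> R"
  shows "\<bar>Im (det (bloch_mat p u l \<nu> y))\<bar> \<le> (p * R ^ p * (2 * R)) * \<kappa> * v"
proof -
  have v: "v > 0" using LR by (simp add: lieb_robinson_def)
  have "cmod (1 / y) = exp (- \<kappa>)" using y by (simp add: norm_divide exp_minus field_simps)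
  then have Y: "cmod y \<le> exp 1" "cmod (1 / y) \<le> exp 1" "1 \<le> exp (1 :: real)" using \<kappa> y by auto
  obtain \<rho> where \<rho>: "det (bloch_mat p u l \<nu> y) = (\<Prod>i<p. \<rho> i)"
    "\<And>i. i < p \<Longrightarrow> eigenvalue (bloch_mat p u l \<nu> y) (\<rho> i)"
    using det_eq_prod_eigenvalues[OF bloch_mat_carrier] by metis
  have \<rho>_le: "cmod (\<rho> i) \<le> R" "\<bar>Im (\<rho> i)\<bar> \<le> 2 * R * \<kappa> * v" if "i < p" for i
  proof -
    have ev: "eigenvalue (bloch_mat p u l \<nu> y) (\<rho> i)" by (rule \<rho>(2)[OF that])
    show \<rho>R: "cmod (\<rho> i) \<le> R"
      using bloch_mat_eigenvalue_le[OF p ev B Y] R by linarith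
    define \<zeta> where "\<zeta> = csqrt (- 4 * \<rho> i)"
    have \<zeta>: "\<zeta>\<^sup>2 = - 4 * \<rho> i" by (simp add: \<zeta>_def)
    show "\<bar>Im (\<rho> i)\<bar> \<le> 2 * R * \<kappa> * v"
    \<comment> \<open>The wave construction divides by \<zeta>; for \<zeta> = 0 the eigenvalue
      itself is 0.\<close>
    proof (cases "\<zeta> = 0")
      case True
      then show ?thesis using \<zeta> \<kappa> v R by simp
    next
      case False
      note Re_le = lieb_robinson_Re_le[where u = u and l = l and \<mu> = \<mu> and \<gamma> = \<gamma> and \<nu> = \<nu>,
          OF u_def l_def LR p per B(1,2) \<kappa>(1,2) y ev]
      have "Re \<zeta> \<le> 2 * \<kappa> * v" "Re (- \<zeta>) \<le> 2 * \<kappa> * v"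
        using False \<zeta> by (auto intro!: Re_le simp del: uminus_complex.simps)
      then have Re: "\<bar>Re \<zeta>\<bar> \<le> 2 * \<kappa> * v" by simp
      have "(cmod \<zeta>)\<^sup>2 = 4 * cmod (\<rho> i)" unfolding norm_power[symmetric] \<zeta> by (simp add: norm_mult)
      also have "\<dots> \<le> 4 * R" using \<rho>R by simp
      also have "\<dots> \<le> (2 * R)\<^sup>2" using R(2) by (simp add: power2_eq_square)
      finally have "cmod \<zeta> \<le> 2 * R" by (rule power2_le_imp_le) (use R in simp)
      then have Im: "\<bar>Im \<zeta>\<bar> \<le> 2 * R" using abs_Im_le_cmod[of \<zeta>] by linarith
      have "4 * \<bar>Im (\<rho> i)\<bar> = \<bar>Im (\<zeta>\<^sup>2)\<bar>" unfolding \<zeta> by simp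
      also have "\<dots> = 2 * (\<bar>Re \<zeta>\<bar> * \<bar>Im \<zeta>\<bar>)" by (simp add: power2_eq_square abs_mult)
      also have "\<dots> \<le> 2 * ((2 * \<kappa> * v) * (2 * R))"
        using Re Im \<kappa> v by (intro mult_left_mono mult_mono) auto
      finally show ?thesis by (simp add: mult_ac)
    qed
  qed
  show ?thesis
    using abs_Im_prod_le[OF R(2) \<rho>_le] unfolding \<rho>(1) by (simp add: mult_ac)
qed

lemma periodic_fun_simple_bounded:
  fixes f :: "int \<Rightarrow> real" and p :: nat
  assumes "p > 0" "periodic_fun_simple f (int p)"
  obtains B where "\<And>k. \<bar>f k\<bar> \<le> B"
proof
  fix k
  have "f k = f (k mod int p)" by (simp add: periodic_fun_simple_mod[OF assms(2)])
  then show "\<bar>f k\<bar> \<le> Max ((\<lambda>i. \<bar>f i\<bar>) ` {0..<int p})"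
    using assms(1) by (auto intro!: Max_ge)
qed

theorem theorem1p3:
  fixes \<mu> \<gamma> \<nu> :: "int \<Rightarrow> real"
  assumes "\<exists>p>0. periodic_fun_simple \<mu> p"
    and "\<exists>p>0. periodic_fun_simple \<gamma> p"
    and "\<exists>p>0. periodic_fun_simple \<nu> p"
    and "\<And>j. \<mu> j \<noteq> 0"
    and "\<And>j. \<gamma> j \<noteq> 1 \<and> \<gamma> j \<noteq> - 1"
  shows "\<exists>v0>0. \<forall>C \<eta> v. lieb_robinson \<mu> \<gamma> \<nu> C \<eta> v \<longrightarrow> v \<ge> v0"
proof (rule ccontr)
  assume "\<not> ?thesis"
  \<comment> \<open>C and \<eta> may depend on v0, so the estimates below must have a constant free
    of both.\<close>
  then have slow: "\<exists>C \<eta> v. lieb_robinson \<mu> \<gamma> \<nu> C \<eta> v \<and> v < v0" if "v0 > 0" for v0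
    using that by (meson not_le)
  obtain p1 p2 p3 :: int where pi: "p1 > 0" "p2 > 0" "p3 > 0" and
    per: "periodic_fun_simple \<mu> p1" "periodic_fun_simple \<gamma> p2" "periodic_fun_simple \<nu> p3"
    using assms(1-3) by blast
  define p where "p = nat (p1 * p2 * p3)"
  have p: "p > 0" and ip: "int p = p1 * p2 * p3" using pi by (simp_all add: p_def)
  have "\<mu> (k + int p) = \<mu> k" "\<gamma> (k + int p) = \<gamma> k" and per_\<nu>: "\<nu> (k + int p) = \<nu> k" for k
    using periodic_fun_simple_plus_multiple[OF per(1), of k "p2 * p3"]
      periodic_fun_simple_plus_multiple[OF per(2), of k "p1 * p3"]
      periodic_fun_simple_plus_multiple[OF per(3), of k "p1 * p2"]
    by (simp_all add: ip mult_ac)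
  define u where "u = (\<lambda>k. \<mu> k * (1 + \<gamma> k))"
  define l where "l = (\<lambda>k. \<mu> k * (1 - \<gamma> k))"
  have per_ul: "u (k + int p) = u k" "l (k + int p) = l k" for k
    by (simp_all add: u_def l_def \<open>\<And>k. \<mu> (k + int p) = \<mu> k\<close> \<open>\<And>k. \<gamma> (k + int p) = \<gamma> k\<close>)
  have nz: "u k \<noteq> 0" "l k \<noteq> 0" for k
    using assms(4,5)[of k] by (auto simp: u_def l_def add_eq_0_iff)
  obtain B1 B2 B3 where "\<And>k. \<bar>u k\<bar> \<le> B1" "\<And>k. \<bar>l k\<bar> \<le> B2" "\<And>k. \<bar>\<nu> k\<bar> \<le> B3"
    using periodic_fun_simple_bounded[OF p] per_ul per_\<nu> unfolding periodic_fun_simple_def by metis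
  then have B: "\<bar>u k\<bar> \<le> max B1 (max B2 B3)" "\<bar>l k\<bar> \<le> max B1 (max B2 B3)" "\<bar>\<nu> k\<bar> \<le> max B1 (max B2 B3)" for k
    by (meson le_max_iff_disj)+
  \<comment> \<open>A bound for all eigenvalues while \<kappa> \<le> 1, that is, while |y| and 1 /
    |y| are at most e. It depends on the chain only.\<close>
  define R where "R = max 1 ((3 * max B1 (max B2 B3) * exp 1)\<^sup>2)"
  have R: "(3 * max B1 (max B2 B3) * exp 1)\<^sup>2 \<le> R" "1 \<le> R" by (auto simp: R_def)
  \<comment> \<open>J e = e^(2 p) D (1 / e), so J 0 is the coefficient of y^(2 p) in D.\<close>
  define J where "J e = det (hop p l (\<lambda>k. u (k - 1)) \<nu> 1 (e\<^sup>2) (- e)) *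
    det (hop p u (\<lambda>k. l (k - 1)) \<nu> 1 (e\<^sup>2) (- e))" for e
  have "J 0 = 0"
  proof (rule eq_0_if_Im_bounded_on_annuli)
    show "J holomorphic_on UNIV"
      unfolding J_def[abs_def] by (intro holomorphic_on_mult det_hop_holomorphic)
    show "2 * p > 0" using p by simp
    show "0 \<le> p * R ^ p * (2 * R)" using R by simp
    show "det (bloch_mat p u l \<nu> y) = y ^ (2 * p) * J (1 / y)" if "y \<noteq> 0" for y
      unfolding J_def by (rule det_bloch_mat[OF that])
    fix v0 :: real assume "v0 > 0"
    then obtain C \<eta> v where LR: "lieb_robinson \<mu> \<gamma> \<nu> C \<eta> v" and v: "v < v0" using slow by blast
    have \<eta>: "\<eta> > 0" using LR by (simp add: lieb_robinson_def)
    \<comment> \<open>In the range of \<kappa>, the bound \<eta> / 2 makes the rate 2 \<kappa>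
      admissible and the bound 1 makes R applicable.\<close>
    have "\<bar>Im (det (bloch_mat p u l \<nu> y))\<bar> \<le> (p * R ^ p * (2 * R)) * \<kappa> * v"
      if "0 < \<kappa>" "\<kappa> < min 1 (\<eta> / 2)" "cmod y = exp \<kappa>" for \<kappa> y
      by (rule lieb_robinson_Im_det_le[where u = u and l = l and \<mu> = \<mu> and \<gamma> = \<gamma> and \<nu> = \<nu>,
          OF u_def l_def LR p per_ul per_\<nu> B that(1) _ _ that(3) R])
        (use that in auto)
    moreover have "min 1 (\<eta> / 2) > 0" using \<eta> by simp
    ultimately show "\<exists>v<v0. \<exists>\<kappa>1>0. \<forall>\<kappa> y. 0 < \<kappa> \<longrightarrow> \<kappa> < \<kappa>1 \<longrightarrow> cmod y = exp \<kappa> \<longrightarrow>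
        \<bar>Im (det (bloch_mat p u l \<nu> y))\<bar> \<le> (p * R ^ p * (2 * R)) * \<kappa> * v"
      using v by blast
  qed
  moreover have "J 0 \<noteq> 0"
    using det_hop_0[OF p, of l] det_hop_0[OF p, of u] nz by (simp add: J_def)
  ultimately show False by simp
qed

end
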